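(* Let $X$ be a prime graph with $\deg(X)\le 4$. Then the realization graph $\mathcal{G}(X)$ is isomorphic to one of ten graphs, according to the following list (the graphs $X$ being taken up to isomorphism): - $\mathcal{G}(X)\approx K_2$ if $X$ is $P_4$; - $\mathcal{G}(X)\approx K_3$ if $X$ is $C_4$, $2K_2$, $D_{2,1}$ or $\overline{D_{2,1}}$; - $\mathcal{G}(X)\approx K_4$ if $X$ is $D_{3,1}$ or $\overline{D_{3,1}}$; - $\mathcal{G}(X)\approx K_{3,3}$ if $X$ is $T_{111}$ or $\overline{T_{111}}$; - $\mathcal{G}(X)\approx K_{1,2,2}$ if $X$ is $T_{221}$, $\overline{T_{221}}$, $R_{211}$ or $\overline{R_{211}}$; - $\mathcal{G}(X)\approx K_5$ if $X$ is $D_{4,1}$ or $\overline{D_{4,1}}$; - $\mathcal{G}(X)\approx K_{2,2,2}$ if $X$ is $D_{2,2}$, $\overline{D_{2,2}}$, $B_1$, $\overline{B_1}$, $B_3$ or $\overline{B_3}$; - $\mathcal{G}(X)\approx K_{1,3,3}$ if $X$ is $B_2$ or $\overline{B_2}$; - $\mathcal{G}(X)\approx \mathcal{G}_1$ if $X$ is $R_{311}$, $\overline{R_{311}}$, $R_{331}$ or $\overline{R_{331}}$; - $\mathcal{G}(X)\approx \mathcal{G}_2$ if $X$ is $R_{321}$ or $\overline{R_{321}}$; and every prime graph $X$ with $\deg(X)\le 4$ appears in this list.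
   Context: Graphs are finite and simple, with nonempty vertex set; $\approx$ is isomorphism and $\overline{G}$ is the complement of $G$. A 2-switch on $G$: given four distinct vertices $a,b,x,y$ with $ab,xy\in E(G)$ and $ax,by\notin E(G)$, delete the edges $ab,xy$ and add the edges $ax,by$ (two 2-switches are equal iff they delete the same two edges and add the same two edges). The 2-switch-degree $\deg(G)$ is the number of distinct 2-switches that can be performed on $G$. A vertex is active in $G$ if it is one of the four vertices involved in some 2-switch on $G$; $G$ is active if all its vertices are active. A split graph is a graph whose vertex set can be partitioned into a clique $K$ and an independent set $I$ (either possibly empty); when such a bipartition is fixed one writes $(S,K,I)$. If $(S,K,I)$ is split and $G$ is a graph vertex-disjoint from $S$, the Tyshkevich composition $(S,K,I)\circ G$ has vertex set $V(S)\cup V(G)$ and edge set $E(S)\cup E(G)\cup\{xy: x\in K,\ y\in V(G)\}$. A graph $G$ is decomposable if $G=S\circ H$ for some $S,H$ with $|S|,|H|\ge1$, and indecomposable otherwise. A graph is prime if it is indecomposable and active. For a graph $X$, the realization graph $\mathcal{G}(X)$ has as vertices all labeled graphs on the vertex set $V(X)$ in which every $v\in V(X)$ has the same degree as in $X$, two of them being adjacent iff one is obtained from the other by a single 2-switch. Named split graphs (clique $K$, independent set $I$, neighborhoods of the vertices of $I$): - $D_{p,q}$ for positive integers $p,q$: $K=\{1,\dots,p+q\}$, $I=\{a,b\}$, $N_a=\{1,\dots,q\}$, $N_b=\{q+1,\dots,p+q\}$. - $T_{111}$: $K=\{1,2,3\}$, $I=\{a,b,c\}$, $N_a=\{1\}$,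 $N_b=\{2\}$, $N_c=\{3\}$. - $T_{221}$: $K=\{1,2,3\}$, $I=\{a,b,c\}$, $N_a=\{2\}$, $N_b=\{1,3\}$, $N_c=\{2,3\}$. - $R_{211}$: $K=\{1,2,3\}$, $I=\{a,b,c\}$, $N_a=N_c=\{1\}$, $N_b=\{2,3\}$. - $R_{311}$: $K=\{1,2,3,4\}$, $I=\{a,b,c\}$, $N_a=\{1\}$, $N_b=\{2\}$, $N_c=\{1,3,4\}$. - $R_{331}$: $K=\{1,2,3,4\}$, $I=\{a,b,c\}$, $N_a=\{1\}$, $N_b=\{2,3,4\}$, $N_c=\{1,3,4\}$. - $R_{321}$: $K=\{1,2,3,4\}$, $I=\{a,b,c\}$, $N_a=\{1\}$, $N_b=\{2,3\}$, $N_c=\{1,3,4\}$. For $j\in\{1,2,3\}$, $B_j$ has vertex set $\{v,c_0,c_1,c_2,c_3\}$, $c_0c_1c_2c_3c_0$ is an induced 4-cycle, and the neighborhood of $v$ is $\{c_0,\dots,c_{j-1}\}$. $K_{n_1,\dots,n_r}$ denotes the complete multipartite graph. $\mathcal{G}_1$ is the graph on $\{o,h_1,\dots,h_6\}$ whose edges are those of the 6-cycle $h_1h_2h_3h_4h_5h_6h_1$, all edges $oh_i$ ($1\le i\le 6$), and $h_1h_3$, $h_4h_6$, $h_2h_5$. $\mathcal{G}_2$ is the graph on $\{c_1,c_2,c_3,c_4,k_1,k_2,k_3,k_4\}$ whose edges are those of the 4-cycle $c_1c_2c_3c_4c_1$, all six edges among $k_1,k_2,k_3,k_4$, and $c_1k_1,c_2k_1,c_2k_2,c_3k_2,c_3k_3,c_4k_3,c_4k_4,c_1k_4$.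 *)

theory Defs
  imports Main
begin

text \<open>A graph is a pair of a vertex set and a set of edges, each edge being a two-element set.\<close>

type_synonym 'a graph = "'a set \<times> 'a set set"

abbreviation verts :: "'a graph \<Rightarrow> 'a set" where
  "verts G \<equiv> fst G"

abbreviation edges :: "'a graph \<Rightarrow> 'a set set" where
  "edges G \<equiv> snd G"

definition all_edges :: "'a set \<Rightarrow> 'a set set" where
  "all_edges V = {{u, v} | u v. u \<in> V \<and> v \<in> V \<and> u \<noteq> v}"

definition graph :: "'a graph \<Rightarrow> bool" where
  "graph G \<longleftrightarrow> finite (verts G) \<and> verts G \<noteq> {} \<and> edges G \<subseteq> all_edges (verts G)"

definition graph_iso :: "'a graph \<Rightarrow> 'b graph \<Rightarrow> bool"  (infix "\<approx>" 50) where
  "G \<approx> H \<longleftrightarrow> (\<exists>f. bij_betw f (verts G) (verts H) \<and>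
     (\<forall>u\<in>verts G. \<forall>v\<in>verts G. {u, v} \<in> edges G \<longleftrightarrow> {f u, f v} \<in> edges H))"

definition graph_complement :: "'a graph \<Rightarrow> 'a graph" where
  "graph_complement G = (verts G, all_edges (verts G) - edges G)"

definition vertex_degree :: "'a graph \<Rightarrow> 'a \<Rightarrow> nat" where
  "vertex_degree G v = card {e \<in> edges G. v \<in> e}"


section \<open>2-switches\<close>

definition switchable :: "'a graph \<Rightarrow> 'a \<Rightarrow> 'a \<Rightarrow> 'a \<Rightarrow> 'a \<Rightarrow> bool" where
  "switchable G a b x y \<longleftrightarrow> distinct [a, b, x, y] \<and> {a, b, x, y} \<subseteq> verts G \<and>
     {a, b} \<in> edges G \<and> {x, y} \<in> edges G \<and> {a, x} \<notin> edges G \<and> {b, y} \<notin> edges G"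

text \<open>A 2-switch is represented by the set of the two edges it deletes paired with the set of
  the two edges it adds, so that different quadruples describing the same 2-switch are identified.\<close>

definition two_switches :: "'a graph \<Rightarrow> ('a set set \<times> 'a set set) set" where
  "two_switches G = {({{a, b}, {x, y}}, {{a, x}, {b, y}}) | a b x y. switchable G a b x y}"

definition apply_switch :: "'a graph \<Rightarrow> 'a set set \<times> 'a set set \<Rightarrow> 'a graph" where
  "apply_switch G s = (verts G, (edges G - fst s) \<union> snd s)"

definition two_switch_degree :: "'a graph \<Rightarrow> nat" where
  "two_switch_degree G = card (two_switches G)"

definition active_vertex :: "'a graph \<Rightarrow> 'a \<Rightarrow> bool" where
  "active_vertex G v \<longleftrightarrow> (\<exists>a b x y. switchable G a b x y \<and> v \<in> {a, b, x, y})"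

definition active_graph :: "'a graph \<Rightarrow> bool" where
  "active_graph G \<longleftrightarrow> (\<forall>v\<in>verts G. active_vertex G v)"


section \<open>Tyshkevich composition and prime graphs\<close>

definition split_partition :: "'a graph \<Rightarrow> 'a set \<Rightarrow> 'a set \<Rightarrow> bool" where
  "split_partition S K I \<longleftrightarrow> K \<union> I = verts S \<and> K \<inter> I = {} \<and>
     all_edges K \<subseteq> edges S \<and> all_edges I \<inter> edges S = {}"

text \<open>The composition depends on the bipartition \<open>(K, I)\<close> of \<open>S\<close> only through \<open>K\<close>.\<close>

definition tyshkevich_comp :: "'a graph \<Rightarrow> 'a set \<Rightarrow> 'a graph \<Rightarrow> 'a graph" where
  "tyshkevich_comp S K G =
     (verts S \<union> verts G, edges S \<union> edges G \<union> {{x, y} | x y. x \<in> K \<and> y \<in> verts G})"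

definition decomposable :: "'a graph \<Rightarrow> bool" where
  "decomposable G \<longleftrightarrow> (\<exists>S K I H. graph S \<and> graph H \<and> split_partition S K I \<and>
     verts S \<inter> verts H = {} \<and> card (verts S) \<ge> 1 \<and> card (verts H) \<ge> 1 \<and>
     G = tyshkevich_comp S K H)"

definition prime_graph :: "'a graph \<Rightarrow> bool" where
  "prime_graph G \<longleftrightarrow> \<not> decomposable G \<and> active_graph G"


section \<open>Realization graph\<close>

definition realizations :: "'a graph \<Rightarrow> 'a graph set" where
  "realizations X = {Y. graph Y \<and> verts Y = verts X \<and>
     (\<forall>v\<in>verts X. vertex_degree Y v = vertex_degree X v)}"

definition realization_graph :: "'a graph \<Rightarrow> 'a graph graph" where
  "realization_graph X =
     (realizations X,
      {{Y, Z} | Y Z. Y \<in> realizations X \<and> Z \<in> realizations X \<and>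
         (\<exists>s\<in>two_switches Y. Z = apply_switch Y s)})"


section \<open>Named graphs\<close>

definition P4 :: "nat graph" where
  "P4 = ({0, 1, 2, 3}, {{0, 1}, {1, 2}, {2, 3}})"

definition C4 :: "nat graph" where
  "C4 = ({0, 1, 2, 3}, {{0, 1}, {1, 2}, {2, 3}, {3, 0}})"

definition two_K2 :: "nat graph" where
  "two_K2 = ({0, 1, 2, 3}, {{0, 1}, {2, 3}})"

text \<open>\<open>B_graph j\<close> is \<open>B\<^sub>j\<close>, with \<open>c\<^sub>i\<close> encoded as \<open>i\<close> and \<open>v\<close> as \<open>4\<close>.\<close>

definition B_graph :: "nat \<Rightarrow> nat graph" where
  "B_graph j = (insert 4 (verts C4), edges C4 \<union> {{4, i} | i. i < j})"

datatype split_vertex = Clq nat | Ind nat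

text \<open>The split graph with clique \<open>Clq 1, \<dots>, Clq k\<close>, independent set \<open>Ind 0, Ind 1, \<dots>\<close> (standing
  for \<open>a, b, \<dots>\<close>), where the neighborhood of \<open>Ind m\<close> is given by the \<open>m\<close>-th entry of the list.\<close>

definition split_graph :: "nat \<Rightarrow> nat set list \<Rightarrow> split_vertex graph" where
  "split_graph k Ns =
     (Clq ` {1..k} \<union> Ind ` {..<length Ns},
      all_edges (Clq ` {1..k}) \<union> {{Clq i, Ind m} | i m. m < length Ns \<and> i \<in> Ns ! m})"

definition D_graph :: "nat \<Rightarrow> nat \<Rightarrow> split_vertex graph" where
  "D_graph p q = split_graph (p + q) [{1..q}, {q + 1..p + q}]"

definition T_111 :: "split_vertex graph" where
  "T_111 = split_graph 3 [{1}, {2}, {3}]"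

definition T_221 :: "split_vertex graph" where
  "T_221 = split_graph 3 [{2}, {1, 3}, {2, 3}]"

definition R_211 :: "split_vertex graph" where
  "R_211 = split_graph 3 [{1}, {2, 3}, {1}]"

definition R_311 :: "split_vertex graph" where
  "R_311 = split_graph 4 [{1}, {2}, {1, 3, 4}]"

definition R_331 :: "split_vertex graph" where
  "R_331 = split_graph 4 [{1}, {2, 3, 4}, {1, 3, 4}]"

definition R_321 :: "split_vertex graph" where
  "R_321 = split_graph 4 [{1}, {2, 3}, {1, 3, 4}]"

definition complete_graph :: "nat \<Rightarrow> nat graph" where
  "complete_graph n = ({..<n}, all_edges {..<n})"

text \<open>The vertex \<open>(i, k)\<close> is the \<open>k\<close>-th vertex of the \<open>i\<close>-th part.\<close>

definition complete_multipartite :: "nat list \<Rightarrow> (nat \<times> nat) graph" where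
  "complete_multipartite ns =
     (let V = {(i, k). i < length ns \<and> k < ns ! i}
      in (V, {{u, v} | u v. u \<in> V \<and> v \<in> V \<and> fst u \<noteq> fst v}))"

text \<open>\<open>calG1\<close> is \<open>\<G>\<^sub>1\<close>, with \<open>o\<close> encoded as \<open>0\<close> and \<open>h\<^sub>i\<close> as \<open>i\<close>.\<close>

definition calG1 :: "nat graph" where
  "calG1 = ({0..6},
     {{1, 2}, {2, 3}, {3, 4}, {4, 5}, {5, 6}, {6, 1}} \<union> {{0, i} | i. i \<in> {1..6}} \<union>
     {{1, 3}, {4, 6}, {2, 5}})"

text \<open>\<open>calG2\<close> is \<open>\<G>\<^sub>2\<close>, with \<open>c\<^sub>i\<close> encoded as \<open>i\<close> and \<open>k\<^sub>i\<close> as \<open>4 + i\<close>.\<close>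

definition calG2 :: "nat graph" where
  "calG2 = ({1..8},
     {{1, 2}, {2, 3}, {3, 4}, {4, 1}} \<union> all_edges {5, 6, 7, 8} \<union>
     {{1, 5}, {2, 5}, {2, 6}, {3, 6}, {3, 7}, {4, 7}, {4, 8}, {1, 8}})"

end

theory Submission
  imports Defs
begin

text \<open>
  A 2-switch is an alternating 4-cycle: edges \<open>ab\<close>, \<open>xy\<close> and non-edges \<open>ax\<close>, \<open>by\<close>. The theorem has two
  independent halves, a classification of the graphs \<open>X\<close> and a determination of \<open>\<G>(X)\<close> for each of them.

  Classification. Some four vertices of a prime graph carry a 2-switch and induce \<open>P4\<close>, \<open>C4\<close> or \<open>2K\<^sub>2\<close>
  (\<open>prime_start\<close>). Let \<open>W\<close> be any nonempty proper set of vertices of an indecomposable graph. An outside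
  vertex is trivial for \<open>W\<close> if it is adjacent to nothing in \<open>W\<close>, to all of \<open>W\<close>, or exactly to the clique of a
  split partition of \<open>W\<close>. If all outside vertices were trivial and compatible with one another, the
  graph would be a Tyshkevich composition, whose outer factor consists of the vertices of the first
  two kinds or, if there are none, of \<open>W\<close> (\<open>trivial_outside_imp_decomposable\<close>). Hence \<open>W\<close> can be enlarged by one
  nontrivial vertex or by two clashing trivial ones. Each 2-switch within \<open>W\<close> is one of the whole graph
  (\<open>switches_le_degree\<close>), so at most four of them ever appear, and this confines the growth: starting from the
  three graphs on four vertices, it stays within 29 graphs on at most seven vertices
  (\<open>catalogue_closed\<close>, a finite computation). A largest induced subgraph in this catalogue cannot be enlarged,
  so it is the whole graph (\<open>indecomposable_has_catalogued_triangle\<close>).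

  Realization graphs. Two labelled graphs with equal degrees differ by one 2-switch exactly if their
  edge sets differ in four elements (\<open>realization_graph_adj\<close>), because removed and added edges balance at every
  vertex. The realization graph is thus obtained by listing all graphs with the given degrees and
  comparing them pairwise (\<open>realization_graph_has_triangle\<close>); for the catalogue the result is compared with the
  ten targets by a search for an isomorphism (\<open>realization_table\<close>).

  All computations work on one representation of a graph on a list of vertices, the upper triangle of
  its adjacency matrix. A graph lies in the isomorphism class of a named graph if and only if it has the
  triangle of that graph for some order of its vertices.
\<close>


section \<open>Adjacency triangles\<close>

abbreviation adj :: "'a graph \<Rightarrow> 'a \<Rightarrow> 'a \<Rightarrow> bool" where
  "adj G u v \<equiv> {u, v} \<in> edges G"

definition loopless :: "'a graph \<Rightarrow> bool" where
  "loopless G \<longleftrightarrow> (\<forall>v. \<not> adj G v v)"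

text \<open>The upper adjacency triangle along a vertex list: the row of a vertex records its adjacency to the
  later vertices only. Prepending a vertex to the list prepends one row and leaves the others
  unchanged, which suits the extension of induced subgraphs by one vertex at a time.\<close>

fun triangle_of :: "('b \<Rightarrow> 'b \<Rightarrow> bool) \<Rightarrow> 'b list \<Rightarrow> bool list list" where
  "triangle_of R [] = []"
| "triangle_of R (v # vs) = map (R v) vs # triangle_of R vs"

definition triangle :: "'a graph \<Rightarrow> 'a list \<Rightarrow> bool list list" where
  "triangle G = triangle_of (adj G)"

lemma triangle_simps [simp]:
  "triangle G [] = []"
  "triangle G (v # vs) = map (adj G v) vs # triangle G vs"
  by (simp_all add: triangle_def)

text \<open>A triangle determines a graph up to isomorphism. Loops are invisible in it and have to be excluded
  separately, because \<open>\<approx>\<close> also compares the singletons \<open>{u, u}\<close>.\<close>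

definition has_triangle :: "'a graph \<Rightarrow> bool list list \<Rightarrow> bool" where
  "has_triangle G M \<longleftrightarrow> loopless G \<and> (\<exists>vs. distinct vs \<and> set vs = verts G \<and> triangle G vs = M)"

lemma length_triangle [simp]: "length (triangle G vs) = length vs"
  by (induction vs) auto

lemma graph_loopless: "graph G \<Longrightarrow> loopless G"
  by (auto simp: graph_def loopless_def all_edges_def subset_iff doubleton_eq_iff)

lemma graph_edgeE:
  assumes "graph G" "e \<in> edges G"
  obtains u v where "e = {u, v}" "u \<in> verts G" "v \<in> verts G" "u \<noteq> v"
proof -
  have "e \<in> all_edges (verts G)"
    using assms by (auto simp: graph_def)
  then show thesis
    using that by (auto simp: all_edges_def)
qed

lemma graph_adjD:
  assumes "graph G" "adj G u v"
  shows "u \<in> verts G \<and> v \<in> verts G \<and> u \<noteq> v"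
  using assms by (auto simp: graph_def all_edges_def subset_iff doubleton_eq_iff)

lemma adj_commute: "adj G u v \<longleftrightarrow> adj G v u"
  by (simp add: insert_commute)

lemma doubleton_in_all_edges: "{u, v} \<in> all_edges V \<longleftrightarrow> u \<in> V \<and> v \<in> V \<and> u \<noteq> v"
  unfolding all_edges_def by (auto simp: doubleton_eq_iff)

lemma triangle_nth:
  "i < j \<Longrightarrow> j < length vs \<Longrightarrow> triangle G vs ! i ! (j - Suc i) = adj G (vs ! i) (vs ! j)"
proof (induction vs arbitrary: i j)
  case (Cons v vs)
  then show ?case by (cases i; cases j) auto
qed simp

lemma triangle_eq_adj:
  assumes "triangle G vs = triangle H ws" "loopless G" "loopless H"
    and "i < length vs" "j < length vs"
  shows "adj G (vs ! i) (vs ! j) = adj H (ws ! i) (ws ! j)"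
proof -
  have len: "length vs = length ws"
    using assms(1) length_triangle by metis
  have *: "adj G (vs ! i) (vs ! j) = adj H (ws ! i) (ws ! j)" if "i < j" "j < length vs" for i j
    using triangle_nth[of i j vs G] triangle_nth[of i j ws H] that assms(1) len by simp
  show ?thesis
    using *[of i j] *[of j i] assms(2-) adj_commute[of _ "vs ! i"] adj_commute[of _ "ws ! i"]
    by (cases i j rule: linorder_cases) (auto simp: loopless_def)
qed

lemma triangle_cong:
  assumes "\<And>u v. u \<in> set vs \<Longrightarrow> v \<in> set vs \<Longrightarrow> adj G u v = adj H (f u) (f v)"
  shows "triangle G vs = triangle H (map f vs)"
  using assms by (induction vs) auto

lemma triangle_eq_triangle_of:
  assumes "distinct vs" "\<And>u v. u \<in> set vs \<Longrightarrow> v \<in> set vs \<Longrightarrow> u \<noteq> v \<Longrightarrow> adj G u v \<longleftrightarrow> R u v"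
  shows "triangle G vs = triangle_of R vs"
  using assms by (induction vs) auto

lemma has_triangleI:
  "loopless G \<Longrightarrow> distinct vs \<Longrightarrow> set vs = verts G \<Longrightarrow> triangle G vs = M \<Longrightarrow> has_triangle G M"
  by (auto simp: has_triangle_def)

lemma has_triangle_imp_iso:
  assumes "has_triangle G M" "has_triangle H M"
  shows "G \<approx> H"
proof -
  obtain vs ws where vs: "distinct vs" "set vs = verts G" "triangle G vs = M" "loopless G"
    and ws: "distinct ws" "set ws = verts H" "triangle H ws = M" "loopless H"
    using assms by (auto simp: has_triangle_def)
  have len: "length vs = length ws"
    using vs(3) ws(3) length_triangle by metis
  define f where "f v = the (map_of (zip vs ws) v)" for v
  have f: "f (vs ! i) = ws ! i" if "i < length vs" for i
    using that vs(1) len by (simp add: f_def map_of_zip_nth)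
  have map: "map f vs = ws"
    using f len by (intro nth_equalityI) auto
  have "bij_betw f (set vs) (set ws)"
    unfolding bij_betw_def using ws(1) map vs(1) by (metis distinct_map set_map)
  moreover have "adj G u v = adj H (f u) (f v)" if uv: "u \<in> set vs" "v \<in> set vs" for u v
  proof -
    obtain i j where "i < length vs" "u = vs ! i" "j < length vs" "v = vs ! j"
      using uv by (metis in_set_conv_nth)
    then show ?thesis
      using f triangle_eq_adj[of G vs H ws i j] vs ws by simp
  qed
  ultimately show ?thesis
    unfolding graph_iso_def vs(2)[symmetric] ws(2)[symmetric] by blast
qed

text \<open>Together with the previous lemma this makes membership in an isomorphism class a statement about
  one concrete triangle.\<close>

lemma iso_has_triangle:
  assumes "graph G" "G \<approx> H" "has_triangle H M"
  shows "has_triangle G M"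
proof -
  obtain f where f: "bij_betw f (verts G) (verts H)"
      "\<And>u v. u \<in> verts G \<Longrightarrow> v \<in> verts G \<Longrightarrow> adj G u v \<longleftrightarrow> adj H (f u) (f v)"
    using assms(2) by (auto simp: graph_iso_def)
  obtain ws where ws: "distinct ws" "set ws = verts H" "triangle H ws = M"
    using assms(3) by (auto simp: has_triangle_def)
  define vs where "vs = map (inv_into (verts G) f) ws"
  have inv: "bij_betw (inv_into (verts G) f) (set ws) (verts G)"
    using f(1) ws(2) by (simp add: bij_betw_inv_into)
  have vs: "distinct vs" "set vs = verts G"
    using inv ws(1) by (auto simp: vs_def distinct_map bij_betw_def)
  have "map f vs = ws"
    unfolding vs_def map_map using f(1) ws(2) by (intro map_idI) (simp add: bij_betw_inv_into_right)
  then have "triangle G vs = M"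
    using triangle_cong[of vs G f H] f(2) vs(2) ws(3) by simp
  then show ?thesis
    using vs graph_loopless[OF assms(1)] by (auto simp: has_triangle_def)
qed

definition co_triangle :: "bool list list \<Rightarrow> bool list list" where
  "co_triangle M = map (map Not) M"

lemma triangle_complement:
  assumes "set vs \<subseteq> verts G" "distinct vs"
  shows "triangle (graph_complement G) vs = co_triangle (triangle G vs)"
  using assms
proof (induction vs)
  case (Cons v vs)
  have "adj (graph_complement G) v u \<longleftrightarrow> \<not> adj G v u" if "u \<in> set vs" for u
    using that Cons.prems by (auto simp: graph_complement_def all_edges_def)
  then show ?case
    using Cons by (simp add: co_triangle_def)
qed (simp add: co_triangle_def)

lemma has_triangle_complement:
  assumes "has_triangle G M"
  shows "has_triangle (graph_complement G) (co_triangle M)"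
proof -
  obtain vs where vs: "distinct vs" "set vs = verts G" "triangle G vs = M"
    using assms by (auto simp: has_triangle_def)
  have "loopless (graph_complement G)"
    by (auto simp: loopless_def graph_complement_def all_edges_def doubleton_eq_iff)
  moreover have "set vs = verts (graph_complement G)"
    using vs(2) by (simp add: graph_complement_def)
  ultimately show ?thesis
    using vs triangle_complement[of vs G] unfolding has_triangle_def by auto
qed


section \<open>Recognizing isomorphic graphs\<close>

fun selections :: "'b list \<Rightarrow> ('b \<times> 'b list) list" where
  "selections [] = []"
| "selections (x # xs) = (x, xs) # map (\<lambda>(y, ys). (y, x # ys)) (selections xs)"

text \<open>All ways to remove one vertex from a triangle: the full adjacency row of that vertex to the others,
  together with the triangle of the others, in the order of \<open>selections\<close>.\<close>

fun pull_out :: "bool list list \<Rightarrow> (bool list \<times> bool list list) list" where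
  "pull_out [] = []"
| "pull_out (r # M) = (r, M) #
     map2 (\<lambda>(b, r') (s, M'). (b # s, r' # M')) (selections r) (pull_out M)"

text \<open>A backtracking search for a vertex order with a prescribed triangle. The rows \<open>R\<close> are given from
  the last one upwards, since the row of a vertex only refers to vertices that come later and hence
  have been placed before. For each vertex still to be placed, \<open>ws\<close> holds its adjacency to the
  vertices already placed, the latest first; a vertex may be placed next if this word is the required
  row.\<close>

fun rearranges :: "bool list list \<Rightarrow> bool list list \<Rightarrow> bool list list \<Rightarrow> bool" where
  "rearranges ws N [] \<longleftrightarrow> N = []"
| "rearranges ws N (r # R) \<longleftrightarrow>
     list_ex (\<lambda>((w, ws'), (s, N')). w = r \<and> rearranges (map2 (#) s ws') N' R)
       (zip (selections ws) (pull_out N))"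

definition same_graph :: "bool list list \<Rightarrow> bool list list \<Rightarrow> bool" where
  "same_graph N M \<longleftrightarrow> length N = length M \<and> rearranges (map (\<lambda>_. []) N) N (rev M)"

lemma selections_map:
  "selections (map f xs) = map (\<lambda>(y, ys). (f y, map f ys)) (selections xs)"
  by (induction xs) auto

lemma zip_maps: "zip (map f xs) (map g xs) = map (\<lambda>x. (f x, g x)) xs"
  by (induction xs) auto

lemma pull_out_triangle:
  "pull_out (triangle G us) = map (\<lambda>(u, vs). (map (adj G u) vs, triangle G vs)) (selections us)"
  by (induction us) (auto simp: selections_map zip_maps adj_commute)

lemma selections_set:
  "(y, ys) \<in> set (selections xs) \<Longrightarrow> 
    set xs = insert y (set ys) \<and> (distinct xs \<longrightarrow> y \<notin> set ys \<and> distinct ys)"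
  by (induction xs arbitrary: ys) fastforce+

text \<open>The induction carries the list \<open>cs\<close> of the vertices already placed.\<close>

lemma rearranges_sound:
  assumes "rearranges (map (\<lambda>u. map (adj G u) cs) us) (triangle G us) R" "distinct (us @ cs)"
  shows "\<exists>vs. distinct vs \<and> set vs = set us \<union> set cs \<and> triangle G vs = rev R @ triangle G cs"
  using assms
proof (induction R arbitrary: us cs)
  case Nil
  then have "us = []" by (cases us) auto
  with Nil show ?case by (intro exI[of _ cs]) auto
next
  case (Cons r R)
  from Cons.prems(1) obtain u rest where u: "(u, rest) \<in> set (selections us)" "map (adj G u) cs = r"
      "rearranges (map2 (#) (map (adj G u) rest) (map (\<lambda>u. map (adj G u) cs) rest)) (triangle G rest) R"
    by (auto simp: pull_out_triangle selections_map zip_maps list_ex_iff )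
  have sel: "set us = insert u (set rest)" "u \<notin> set rest" "distinct rest"
    using selections_set[OF u(1)] Cons.prems(2) by auto
  have "rearranges (map (\<lambda>x. map (adj G x) (u # cs)) rest) (triangle G rest) R"
    using u(3) by (simp add: zip_maps adj_commute o_def)
  moreover have "distinct (rest @ u # cs)"
    using sel Cons.prems(2) by auto
  ultimately obtain vs where "distinct vs" "set vs = set rest \<union> set (u # cs)"
      "triangle G vs = rev R @ triangle G (u # cs)"
    using Cons.IH by blast
  then show ?case
    using sel u(2) by (intro exI[of _ vs]) auto
qed

lemma same_graph_sound:
  assumes "same_graph (triangle G us) M" "distinct us"
  shows "\<exists>vs. distinct vs \<and> set vs = set us \<and> triangle G vs = M"
proof -
  have "map (\<lambda>_. []) (triangle G us) = map (\<lambda>u. map (adj G u) []) us"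
    by (simp add: map_replicate_const)
  with assms rearranges_sound[of G "[]" us "rev M"] show ?thesis
    by (auto simp: same_graph_def)
qed

lemma has_triangle_same_graph:
  "has_triangle G N \<Longrightarrow> same_graph N M \<Longrightarrow> has_triangle G M"
  unfolding has_triangle_def using same_graph_sound[of G _ M] by metis


section \<open>Enumerating the realizations of a degree sequence\<close>

text \<open>All rows with \<open>d\<close> neighbours, each with the degrees that the later vertices still have to receive
  from one another. A later vertex of remaining degree \<open>0\<close> cannot be chosen.\<close>

fun choose_row :: "nat \<Rightarrow> nat list \<Rightarrow> (bool list \<times> nat list) list" where
  "choose_row d [] = (if d = 0 then [([], [])] else [])"
| "choose_row d (e # es) = map (\<lambda>(r, x). (False # r, e # x)) (choose_row d es) @
     (case d of 0 \<Rightarrow> [] | Suc d' \<Rightarrow> (case e of 0 \<Rightarrow> []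
       | Suc e' \<Rightarrow> map (\<lambda>(r, x). (True # r, e' # x)) (choose_row d' es)))"

text \<open>The degree of a vertex is the number of its neighbours among the later vertices plus a contribution
  of one for each earlier row in which it is marked.\<close>

fun degrees :: "bool list list \<Rightarrow> nat list" where
  "degrees [] = []"
| "degrees (r # M) = length (filter id r) # map2 (\<lambda>b d. if b then Suc d else d) r (degrees M)"

fun triangular :: "bool list list \<Rightarrow> bool" where
  "triangular [] \<longleftrightarrow> True"
| "triangular (r # M) \<longleftrightarrow> length r = length M \<and> triangular M"

lemma choose_row_iff:
  "(r, x) \<in> set (choose_row d es) \<longleftrightarrow> length r = length es \<and> length x = length es \<and>
     length (filter id r) = d \<and> map2 (\<lambda>b d. if b then Suc d else d) r x = es"
proof (induction es arbitrary: r x d)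
  case Nil
  then show ?case by auto
next
  case (Cons e es)
  show ?case
  proof (cases "\<exists>b r' e' x'. r = b # r' \<and> x = e' # x'")
    case False
    then show ?thesis
      by (cases r; cases x) (auto split: nat.splits)
  next
    case True
    then obtain b r' e' x' where [simp]: "r = b # r'" "x = e' # x'" by blast
    have *: "(r, x) \<in> set (choose_row d (e # es)) \<longleftrightarrow>
        (if b then d \<noteq> 0 \<and> e \<noteq> 0 \<and> e' = e - 1 \<and> (r', x') \<in> set (choose_row (d - 1) es)
         else e' = e \<and> (r', x') \<in> set (choose_row d es))"
      by (cases b; cases d; cases e) force+
    show ?thesis
      unfolding * Cons.IH by (cases b; cases d; cases e; simp add: id_def; argo?)
  qed
qed

lemma length_choose_row: "(r, x) \<in> set (choose_row d es) \<Longrightarrow> length x = length es"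
  by (simp add: choose_row_iff)

function triangles_with_degrees :: "nat list \<Rightarrow> bool list list list" where
  "triangles_with_degrees [] = [[]]"
| "triangles_with_degrees (d # ds) =
     concat (map (\<lambda>(r, x). map ((#) r) (triangles_with_degrees x)) (choose_row d ds))"
  by pat_completeness auto

termination
  by (relation "measure length") (auto dest: length_choose_row)

lemma length_degrees: "triangular M \<Longrightarrow> length (degrees M) = length M"
  by (induction M) auto

lemma triangular_triangle: "triangular (triangle G vs)"
  by (induction vs) auto

text \<open>The enumeration is exact: a triangle is determined by its first row and the triangle of the later
  vertices, whose degrees are the given ones diminished by the first row.\<close>

lemma triangles_with_degrees_iff:
  "M \<in> set (triangles_with_degrees ds) \<longleftrightarrow> triangular M \<and> degrees M = ds"
proof (induction ds arbitrary: M rule: triangles_with_degrees.induct)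
  case 1
  then show ?case by (cases M) auto
next
  case (2 d ds)
  show ?case
  proof (cases M)
    case Nil
    then show ?thesis by auto
  next
    case (Cons r N)
    have "M \<in> set (triangles_with_degrees (d # ds)) \<longleftrightarrow>
        (\<exists>x. (r, x) \<in> set (choose_row d ds) \<and> N \<in> set (triangles_with_degrees x))"
      by (auto simp: Cons image_iff split: prod.splits)
    also have "\<dots> \<longleftrightarrow> triangular N \<and> (r, degrees N) \<in> set (choose_row d ds)"
      using 2[OF _ refl] by metis
    also have "\<dots> \<longleftrightarrow> triangular M \<and> degrees M = d # ds"
    proof (cases "triangular N")
      case True
      have "length r = length ds \<and> length (degrees N) = length ds \<longleftrightarrow> length r = length N"
        if "map2 (\<lambda>b d. if b then Suc d else d) r (degrees N) = ds"
      proof -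
        have "length ds = min (length r) (length N)"
          using that[symmetric] length_degrees[OF True] by simp
        then show ?thesis
          using length_degrees[OF True] by (metis min.idem)
      qed
      then show ?thesis
        using True unfolding Cons choose_row_iff triangular.simps degrees.simps list.inject by argo
    qed (simp add: Cons)
    finally show ?thesis .
  qed
qed

lemma length_filter_map: "distinct vs \<Longrightarrow> length (filter id (map P vs)) = card {u \<in> set vs. P u}"
  by (simp add: filter_map distinct_length_filter comp_def Int_def conj_commute)

lemma degrees_triangle:
  assumes "distinct vs" "loopless G"
  shows "degrees (triangle G vs) = map (\<lambda>v. card {u \<in> set vs. adj G v u}) vs"
  using assms(1)
proof (induction vs)
  case (Cons v vs)
  have "card {u \<in> set (v # vs). adj G v u} = length (filter id (map (adj G v) vs))"
  proof -
    have "{u \<in> set (v # vs). adj G v u} = {u \<in> set vs. adj G v u}"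
      using assms(2) by (auto simp: loopless_def)
    then show ?thesis
      using Cons.prems by (simp only: length_filter_map distinct.simps)
  qed
  moreover have "card {w \<in> set (v # vs). adj G u w} =
      (if adj G v u then Suc (card {w \<in> set vs. adj G u w}) else card {w \<in> set vs. adj G u w})"
    if "u \<in> set vs" for u
  proof -
    have "{w \<in> set (v # vs). adj G u w} =
        (if adj G v u then insert v {w \<in> set vs. adj G u w} else {w \<in> set vs. adj G u w})"
      by (auto simp: adj_commute)
    then show ?thesis
      using Cons.prems by simp
  qed
  ultimately show ?case
    using Cons by (simp add: zip_maps)
qed simp

lemma vertex_degree_eq_card_neighbours:
  assumes "graph G"
  shows "vertex_degree G v = card {u \<in> verts G. adj G v u}"
proof -
  have "{e \<in> edges G. v \<in> e} = (\<lambda>u. {v, u}) ` {u \<in> verts G. adj G v u}"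
  proof (intro equalityI subsetI)
    fix e assume "e \<in> {e \<in> edges G. v \<in> e}"
    then have e: "e \<in> edges G" "v \<in> e" by auto
    obtain a b where "e = {a, b}" "a \<in> verts G" "b \<in> verts G"
      using graph_edgeE[OF assms e(1)] by metis
    then show "e \<in> (\<lambda>u. {v, u}) ` {u \<in> verts G. adj G v u}"
      using e by (auto simp: insert_commute)
  qed auto
  then show ?thesis
    unfolding vertex_degree_def by (simp add: card_image inj_on_def doubleton_eq_iff)
qed

lemma triangle_degrees_iff:
  assumes "graph Y" "graph X" "verts Y = verts X" "distinct vs" "set vs = verts X"
  shows "(\<forall>v\<in>verts X. vertex_degree Y v = vertex_degree X v) \<longleftrightarrow>
    degrees (triangle Y vs) = degrees (triangle X vs)"
proof -
  have "degrees (triangle Z vs) = map (vertex_degree Z) vs" if "graph Z" "verts Z = set vs" for Z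
    using that degrees_triangle[OF assms(4) graph_loopless[OF that(1)]]
    by (simp add: vertex_degree_eq_card_neighbours)
  then show ?thesis
    using assms by simp
qed

lemma all_edges_mono: "A \<subseteq> B \<Longrightarrow> all_edges A \<subseteq> all_edges B"
  unfolding all_edges_def by blast

text \<open>With \<open>triangle_inj\<close> below: along a fixed list of its vertices, labelled graphs and triangles
  correspond one to one, so counting realizations is counting triangles.\<close>

lemma triangle_surj:
  assumes "triangular M" "length vs = length M" "distinct vs"
  shows "\<exists>E \<subseteq> all_edges (set vs). triangle (V, E) vs = M"
  using assms
proof (induction M arbitrary: vs)
  case Nil
  then show ?case by auto
next
  case (Cons r M)
  then obtain v us where vs: "vs = v # us" "length us = length M" "v \<notin> set us" "distinct us"
    by (cases vs) auto
  then obtain E where E: "E \<subseteq> all_edges (set us)" "triangle (V, E) us = M"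
    using Cons.IH[of us] Cons.prems by auto
  define F where "F = {{v, us ! i} | i. i < length us \<and> r ! i}"
  have nv: "e \<in> E \<Longrightarrow> v \<notin> e" for e
    using E(1) vs(3) by (auto simp: all_edges_def)
  have "triangle (V, E \<union> F) us = triangle (V, E) (map id us)"
    using vs(3) by (intro triangle_cong) (auto simp: F_def doubleton_eq_iff)
  moreover have "map (\<lambda>u. {v, u} \<in> E \<union> F) us = r"
  proof (rule nth_equalityI)
    fix i assume "i < length (map (\<lambda>u. {v, u} \<in> E \<union> F) us)"
    then show "map (\<lambda>u. {v, u} \<in> E \<union> F) us ! i = r ! i"
      using nv[of "{v, us ! i}"] vs(3,4) by (auto simp: F_def doubleton_eq_iff nth_eq_iff_index_eq)
  qed (use Cons.prems vs in auto)
  moreover have "E \<union> F \<subseteq> all_edges (set vs)"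
  proof -
    have "F \<subseteq> all_edges (set vs)"
      using vs(3) unfolding F_def all_edges_def vs(1) by (auto) (metis nth_mem)
    then show ?thesis
      using E(1) vs(1) all_edges_mono[of "set us" "set vs"] by auto
  qed
  ultimately show ?case
    using E(2) vs(1) by (intro exI[of _ "E \<union> F"]) auto
qed

lemma triangle_inj:
  assumes "graph Y" "graph Z" "set vs = verts Y" "set vs = verts Z" "triangle Y vs = triangle Z vs"
  shows "Y = Z"
proof -
  have adj: "adj Y u v = adj Z u v" if uv: "u \<in> set vs" "v \<in> set vs" for u v
  proof -
    obtain i j where "i < length vs" "u = vs ! i" "j < length vs" "v = vs ! j"
      using uv by (metis in_set_conv_nth)
    then show ?thesis
      using triangle_eq_adj[of Y vs Z vs] assms(1,2,5) graph_loopless by blast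
  qed
  have "e \<in> edges Y \<longleftrightarrow> e \<in> edges Z" for e
    using adj graph_edgeE[OF assms(1), of e] graph_edgeE[OF assms(2), of e] assms(3,4) by metis
  then show ?thesis
    using assms(3,4) by (auto simp: prod_eq_iff)
qed


section \<open>Adjacency in the realization graph\<close>

fun discrepancy :: "bool list list \<Rightarrow> bool list list \<Rightarrow> nat" where
  "discrepancy (r # M) (s # N) =
     length (filter (\<lambda>(a, b). a \<noteq> b) (zip r s)) + discrepancy M N"
| "discrepancy _ _ = 0"

fun discrepancy_triangle :: "bool list list list \<Rightarrow> bool list list" where
  "discrepancy_triangle [] = []"
| "discrepancy_triangle (M # Ms) = map (\<lambda>N. discrepancy M N = 4) Ms # discrepancy_triangle Ms"

definition realization_triangle :: "bool list list \<Rightarrow> bool list list" where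
  "realization_triangle M = discrepancy_triangle (remdups (triangles_with_degrees (degrees M)))"

lemma filter_zip_maps:
  "distinct vs \<Longrightarrow>
    length (filter (\<lambda>(a, b). a \<noteq> b) (zip (map P vs) (map Q vs))) = card {u \<in> set vs. P u \<noteq> Q u}"
  by (simp add: zip_maps filter_map distinct_length_filter comp_def Int_def conj_commute)

lemma all_edges_insert: "all_edges (insert v S) = all_edges S \<union> (\<lambda>u. {v, u}) ` (S - {v})"
  unfolding all_edges_def by (auto simp: insert_commute)

lemma finite_all_edges: "finite V \<Longrightarrow> finite (all_edges V)"
  by (rule finite_subset[of _ "Pow V"]) (auto simp: all_edges_def)

text \<open>A triangle lists each pair of vertices exactly once, so positions at which two triangles differ are
  pairs on which the graphs differ.\<close>

lemma discrepancy_triangle_eq: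
  assumes "distinct vs"
  shows "discrepancy (triangle G vs) (triangle H vs) =
    card {e \<in> all_edges (set vs). (e \<in> edges G) \<noteq> (e \<in> edges H)}"
  using assms
proof (induction vs)
  case Nil
  then show ?case by (simp add: all_edges_def)
next
  case (Cons v vs)
  let ?D = "\<lambda>e. (e \<in> edges G) \<noteq> (e \<in> edges H)"
  let ?A = "(\<lambda>u. {v, u}) ` {u \<in> set vs. ?D {v, u}}"
  have "{e \<in> all_edges (set (v # vs)). ?D e} = ?A \<union> {e \<in> all_edges (set vs). ?D e}"
    using Cons.prems by (auto simp: all_edges_insert)
  moreover have "?A \<inter> {e \<in> all_edges (set vs). ?D e} = {}"
    using Cons.prems by (auto simp: all_edges_def doubleton_eq_iff)
  moreover have "card ?A = card {u \<in> set vs. ?D {v, u}}"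
    by (intro card_image) (auto simp: inj_on_def doubleton_eq_iff)
  moreover have "finite {e \<in> all_edges (set vs). ?D e}"
    by (simp add: finite_all_edges)
  ultimately have "card {e \<in> all_edges (set (v # vs)). ?D e} =
      card {u \<in> set vs. ?D {v, u}} + card {e \<in> all_edges (set vs). ?D e}"
    using card_Un_disjoint[of ?A "{e \<in> all_edges (set vs). ?D e}"] by simp
  then show ?case
    using Cons filter_zip_maps[of vs "adj G v" "adj H v"] by simp
qed

lemma discrepancy_graphs:
  assumes "graph Y" "graph Z" "verts Y = set vs" "verts Z = set vs" "distinct vs"
  shows "discrepancy (triangle Y vs) (triangle Z vs) =
    card ((edges Y - edges Z) \<union> (edges Z - edges Y))"
proof -
  have "{e \<in> all_edges (set vs). (e \<in> edges Y) \<noteq> (e \<in> edges Z)} =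
      (edges Y - edges Z) \<union> (edges Z - edges Y)"
    using assms by (auto simp: graph_def)
  then show ?thesis
    using discrepancy_triangle_eq[OF assms(5), of Y Z] by simp
qed

lemma vertex_degree_balance:
  assumes "graph Y" "graph Z" "vertex_degree Y v = vertex_degree Z v"
  shows "card {e \<in> edges Y - edges Z. v \<in> e} = card {e \<in> edges Z - edges Y. v \<in> e}"
proof -
  have fin: "finite (edges G)" if "graph G" for G :: "'a graph"
    using that finite_all_edges finite_subset unfolding graph_def by metis
  let ?C = "{e \<in> edges Y \<inter> edges Z. v \<in> e}"
  have "{e \<in> edges Y. v \<in> e} = ?C \<union> {e \<in> edges Y - edges Z. v \<in> e}"
    "{e \<in> edges Z. v \<in> e} = ?C \<union> {e \<in> edges Z - edges Y. v \<in> e}"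
    by auto
  moreover have "card (?C \<union> {e \<in> edges Y - edges Z. v \<in> e}) =
      card ?C + card {e \<in> edges Y - edges Z. v \<in> e}"
    "card (?C \<union> {e \<in> edges Z - edges Y. v \<in> e}) =
      card ?C + card {e \<in> edges Z - edges Y. v \<in> e}"
    using fin[OF assms(1)] fin[OF assms(2)] by (auto intro!: card_Un_disjoint)
  ultimately show ?thesis
    using assms(3) by (simp add: vertex_degree_def)
qed

text \<open>For two graphs with equal degrees, differing in four pairs is already being one 2-switch apart:
  at every vertex the removed and added edges balance, so the four pairs form an alternating closed
  walk, and the only such walk of length four is an alternating 4-cycle. This turns adjacency in the
  realization graph into counting.\<close>

lemma exchange_imp_switch:
  assumes Y: "graph Y" and Z: "graph Z" and V: "verts Y = verts Z"
    and deg: "\<And>v. v \<in> verts Y \<Longrightarrow> vertex_degree Y v = vertex_degree Z v"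
    and four: "card ((edges Y - edges Z) \<union> (edges Z - edges Y)) = 4"
  shows "\<exists>s\<in>two_switches Y. Z = apply_switch Y s"
proof -
  let ?R = "edges Y - edges Z" and ?A = "edges Z - edges Y"
  have fin: "finite (?R \<union> ?A)"
    using four by (metis card.infinite zero_neq_numeral)
  have balance: "card {e \<in> ?R. v \<in> e} = card {e \<in> ?A. v \<in> e}" if "v \<in> verts Y" for v
    using vertex_degree_balance[OF Y Z deg[OF that]] .
  \<comment> \<open>Every vertex lies on as many removed as added edges, so an alternating walk never gets
    stuck. The walk below leaves a removed edge \<open>ab\<close> at both ends and uses up the four edges.\<close>
  have removed_iff: "(\<exists>u. {v, u} \<in> ?R) \<longleftrightarrow> (\<exists>u. {v, u} \<in> ?A)" if v: "v \<in> verts Y" for v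
  proof -
    have ends: "(\<exists>u. {v, u} \<in> S) \<longleftrightarrow> {e \<in> S. v \<in> e} \<noteq> {}" if S: "S \<subseteq> edges Y \<or> S \<subseteq> edges Z" for S
    proof -
      have "\<exists>u. {v, u} \<in> S" if e: "e \<in> S" "v \<in> e" for e
      proof -
        obtain p q where "e = {p, q}"
          using e(1) S Y Z by (metis graph_edgeE subsetD)
        with e have "v = p \<and> {v, q} \<in> S \<or> v = q \<and> {v, p} \<in> S"
          by (auto simp: insert_commute)
        then show ?thesis by blast
      qed
      then show ?thesis by blast
    qed
    have "card {e \<in> ?R. v \<in> e} = 0 \<longleftrightarrow> {e \<in> ?R. v \<in> e} = {}"
      "card {e \<in> ?A. v \<in> e} = 0 \<longleftrightarrow> {e \<in> ?A. v \<in> e} = {}"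
      by (rule card_0_eq, rule finite_subset[OF _ fin], blast)+
    then show ?thesis
      using balance[OF v] ends[of ?R] ends[of ?A] by auto
  qed
  have "?R \<noteq> {}"
  proof
    assume "?R = {}"
    with four have "?A \<noteq> {}" by auto
    then obtain e where e: "e \<in> ?A" by blast
    then obtain u v where "e = {u, v}" "u \<in> verts Y"
      using graph_edgeE[OF Z] V e by (metis DiffD1)
    then show False
      using removed_iff[of u] e \<open>?R = {}\<close> by auto
  qed
  then obtain e where e: "e \<in> ?R" by auto
  then obtain a b where ab: "e = {a, b}" "a \<in> verts Y" "b \<in> verts Y" "a \<noteq> b"
    using graph_edgeE[OF Y, of e] by auto
  obtain x where x: "{a, x} \<in> ?A"
    using removed_iff[OF ab(2)] e ab(1) by auto
  obtain y where y: "{b, y} \<in> ?A"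
    using removed_iff[OF ab(3)] e ab(1) by (auto simp: insert_commute)
  have nx: "x \<in> verts Y" "x \<noteq> a" "x \<noteq> b" and ny: "y \<in> verts Y" "y \<noteq> b" "y \<noteq> a"
    using graph_adjD[OF Z, of a x] graph_adjD[OF Z, of b y] x y e ab V by (auto simp: insert_commute)
  obtain z where z: "{x, z} \<in> ?R"
    using removed_iff[OF nx(1)] x by (auto simp: insert_commute)
  have nz: "z \<noteq> x" using graph_adjD[OF Y, of x z] z by auto
  have all: "?R \<union> ?A = {{a, b}, {x, z}, {a, x}, {b, y}}"
  proof -
    have "card {{a, b}, {x, z}, {a, x}, {b, y}} = 4"
    proof -
      have "{a, b} \<noteq> {x, z}" "{a, x} \<noteq> {b, y}"
        using ab(4) nx ny by (auto simp: doubleton_eq_iff)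
      moreover have "{a, b} \<noteq> {a, x}" "{a, b} \<noteq> {b, y}" "{x, z} \<noteq> {a, x}" "{x, z} \<noteq> {b, y}"
        using x y z e ab(1) by auto
      ultimately show ?thesis by simp
    qed
    then show ?thesis
      using card_subset_eq[OF fin, of "{{a, b}, {x, z}, {a, x}, {b, y}}"] x y z e ab four by auto
  qed
  have R: "?R = {{a, b}, {x, z}}" and A: "?A = {{a, x}, {b, y}}"
    using all x y z e ab by auto
  \<comment> \<open>Two added edges at \<open>x\<close> would need two removed edges at \<open>x\<close>, but only \<open>xz\<close> is left.\<close>
  have xy: "x \<noteq> y"
  proof
    assume "x = y"
    then have A': "{e \<in> ?A. x \<in> e} = {{a, x}, {b, x}}" and R': "{e \<in> ?R. x \<in> e} = {{x, z}}"
      unfolding R A using nx by auto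
    have "{a, x} \<noteq> {b, x}"
      using ab(4) by (auto simp: doubleton_eq_iff)
    then show False
      using balance[OF nx(1)] unfolding A' R' by simp
  qed
  obtain w where "{y, w} \<in> ?R"
    using removed_iff[OF ny(1)] y by (auto simp: insert_commute)
  then have "z = y"
    unfolding R using ny xy by (auto simp: doubleton_eq_iff)
  then have "switchable Y a b x y"
    unfolding switchable_def using x y z e ab nx ny xy by auto
  then have "({{a, b}, {x, y}}, {{a, x}, {b, y}}) \<in> two_switches Y"
    unfolding two_switches_def by blast
  moreover have "Z = apply_switch Y ({{a, b}, {x, y}}, {{a, x}, {b, y}})"
  proof -
    have "edges Z = (edges Y - ?R) \<union> ?A" by auto
    then show ?thesis
      using R A V \<open>z = y\<close> by (simp add: apply_switch_def prod_eq_iff)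
  qed
  ultimately show ?thesis by blast
qed

lemma switch_imp_exchange:
  assumes "s \<in> two_switches Y" "Z = apply_switch Y s"
  shows "card ((edges Y - edges Z) \<union> (edges Z - edges Y)) = 4"
proof -
  obtain a b x y where s: "s = ({{a, b}, {x, y}}, {{a, x}, {b, y}})" "switchable Y a b x y"
    using assms(1) by (auto simp: two_switches_def)
  have "(edges Y - edges Z) \<union> (edges Z - edges Y) = {{a, b}, {x, y}, {a, x}, {b, y}}"
    using s assms(2) by (auto simp: apply_switch_def switchable_def doubleton_eq_iff)
  moreover have "card {{a, b}, {x, y}, {a, x}, {b, y}} = 4"
    using s(2) by (auto simp: switchable_def doubleton_eq_iff card_insert_if)
  ultimately show ?thesis by simp
qed

text \<open>The realization graph joins unordered pairs, whereas a 2-switch has a direction. The criterion is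
  symmetric, so both directions agree.\<close>

lemma realization_graph_adj:
  assumes "Y \<in> realizations X" "Z \<in> realizations X"
  shows "adj (realization_graph X) Y Z \<longleftrightarrow>
    card ((edges Y - edges Z) \<union> (edges Z - edges Y)) = 4"
proof -
  have one: "(\<exists>s\<in>two_switches Y. Z = apply_switch Y s) \<longleftrightarrow>
      card ((edges Y - edges Z) \<union> (edges Z - edges Y)) = 4"
    if "Y \<in> realizations X" "Z \<in> realizations X" for Y Z
    using exchange_imp_switch[of Y Z] switch_imp_exchange[of _ Y Z] that
    by (auto simp: realizations_def)
  have "adj (realization_graph X) Y Z \<longleftrightarrow>
      (\<exists>s\<in>two_switches Y. Z = apply_switch Y s) \<or> (\<exists>s\<in>two_switches Z. Y = apply_switch Z s)"
    using assms unfolding realization_graph_def snd_conv mem_Collect_eq doubleton_eq_iff by metis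
  then show ?thesis
    using one[OF assms] one[OF assms(2,1)] by (simp add: Un_commute)
qed

lemma realization_graph_loopless: "loopless (realization_graph X)"
proof -
  have "Y \<in> realizations X" if "adj (realization_graph X) Y Y" for Y
    using that by (auto simp: realization_graph_def doubleton_eq_iff)
  then show ?thesis
    using realization_graph_adj unfolding loopless_def by fastforce
qed

lemma triangle_discrepancy_triangle:
  assumes "\<And>Y Z. Y \<in> set Ys \<Longrightarrow> Z \<in> set Ys \<Longrightarrow> adj G Y Z \<longleftrightarrow> discrepancy (f Y) (f Z) = 4"
  shows "triangle G Ys = discrepancy_triangle (map f Ys)"
  using assms by (induction Ys) auto

text \<open>The realization graph of a concrete graph is thereby computable: list the triangles with its degree
  sequence and join those that differ in four positions. Duplicates are removed because the
  vertices of the realization graph have to be listed without repetition.\<close>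

theorem realization_graph_has_triangle:
  assumes X: "graph X" and M: "has_triangle X M"
  shows "has_triangle (realization_graph X) (realization_triangle M)"
proof -
  obtain vs where vs: "distinct vs" "set vs = verts X" "triangle X vs = M"
    using M by (auto simp: has_triangle_def)
  define code where "code Y = triangle Y vs" for Y :: "'a graph"
  let ?Ms = "remdups (triangles_with_degrees (degrees M))"
  have inj: "inj_on code (realizations X)"
    using triangle_inj[of _ _ vs] vs(2) by (auto simp: inj_on_def code_def realizations_def)
  have "code ` realizations X = set ?Ms"
  proof (intro equalityI subsetI)
    fix N assume "N \<in> code ` realizations X"
    then obtain Y where Y: "Y \<in> realizations X" "N = triangle Y vs"
      by (auto simp: code_def)
    then show "N \<in> set ?Ms"
      using triangle_degrees_iff[of Y X vs] X vs
      by (auto simp: realizations_def triangles_with_degrees_iff triangular_triangle)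
  next
    fix N assume "N \<in> set ?Ms"
    then have N: "triangular N" "degrees N = degrees M"
      by (auto simp: triangles_with_degrees_iff)
    have "length N = length vs"
      using N vs(3) length_degrees triangular_triangle length_triangle by metis
    then obtain E where E: "E \<subseteq> all_edges (set vs)" "triangle (verts X, E) vs = N"
      using triangle_surj[OF N(1) _ vs(1), of "verts X"] by auto
    have "graph (verts X, E)"
      using E(1) X vs(2) by (simp add: graph_def)
    then have "(verts X, E) \<in> realizations X"
      using triangle_degrees_iff[of "(verts X, E)" X vs] X vs E(2) N(2) by (simp add: realizations_def)
    then show "N \<in> code ` realizations X"
      using E(2) unfolding code_def by blast
  qed
  then have bij: "bij_betw code (realizations X) (set ?Ms)"
    using inj by (simp add: bij_betw_def)
  \<comment> \<open>The realizations are listed in the order of their triangles, so that the triangle of the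
    realization graph is the one computed from the enumeration.\<close>
  define Ys where "Ys = map (inv_into (realizations X) code) ?Ms"
  have Ys: "set Ys = realizations X" "distinct Ys" "map code Ys = ?Ms"
  proof -
    have inv: "bij_betw (inv_into (realizations X) code) (set ?Ms) (realizations X)"
      using bij by (rule bij_betw_inv_into)
    then show "set Ys = realizations X"
      unfolding Ys_def by (simp add: bij_betw_def)
    show "distinct Ys"
      using inv unfolding Ys_def distinct_map bij_betw_def by blast
    show "map code Ys = ?Ms"
      unfolding Ys_def map_map using bij by (intro map_idI) (simp add: bij_betw_inv_into_right)
  qed
  have "triangle (realization_graph X) Ys = discrepancy_triangle (map code Ys)"
  proof (rule triangle_discrepancy_triangle)
    fix Y Z assume "Y \<in> set Ys" "Z \<in> set Ys"
    then have YZ: "Y \<in> realizations X" "Z \<in> realizations X" by (auto simp: Ys)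
    then show "adj (realization_graph X) Y Z \<longleftrightarrow> discrepancy (code Y) (code Z) = 4"
      using realization_graph_adj[OF YZ] discrepancy_graphs[of Y Z vs] vs
      by (simp add: realizations_def code_def)
  qed
  then have "triangle (realization_graph X) Ys = realization_triangle M"
    unfolding Ys realization_triangle_def .
  moreover have "verts (realization_graph X) = realizations X"
    by (simp add: realization_graph_def)
  ultimately show ?thesis
    using Ys realization_graph_loopless unfolding has_triangle_def by metis
qed


section \<open>Counting 2-switches\<close>

text \<open>For the indicator words of two vertex sets, the size of their difference.\<close>

fun excess :: "bool list \<Rightarrow> bool list \<Rightarrow> nat" where
  "excess (True # r) (False # s) = Suc (excess r s)"
| "excess (True # r) (True # s) = excess r s"
| "excess (False # r) (b # s) = excess r s"
| "excess [] s = 0"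
| "excess r [] = 0"

text \<open>The symmetric adjacency matrix with empty diagonal.\<close>

fun full_rows :: "bool list list \<Rightarrow> bool list list" where
  "full_rows [] = []"
| "full_rows (r # M) = (False # r) # map2 (#) r (full_rows M)"

text \<open>The sum over \<open>x\<close> of \<open>|N(v) - N[x]| * |N(x) - N[v]|\<close>, where \<open>r\<close> is the row of \<open>v\<close>, \<open>bs\<close> tells which
  \<open>x\<close> are neighbours of \<open>v\<close>, and \<open>F\<close> lists the open neighbourhoods \<open>N(x)\<close>. A neighbour \<open>x\<close> of \<open>v\<close>
  lies in \<open>N(v)\<close> but not in \<open>N(x)\<close>; the subtraction of one takes it out again.\<close>

fun switches_through :: "bool list \<Rightarrow> bool list \<Rightarrow> bool list list \<Rightarrow> nat" where
  "switches_through r (True # bs) (f # F) = (excess r f - 1) * excess f r + switches_through r bs F"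
| "switches_through r (False # bs) (f # F) = excess r f * excess f r + switches_through r bs F"
| "switches_through r [] F = 0"
| "switches_through r bs [] = 0"

fun switches :: "bool list list \<Rightarrow> nat" where
  "switches [] = 0"
| "switches (r # M) = switches_through r r (full_rows M) + switches M"

lemma excess_map:
  assumes "distinct vs"
  shows "excess (map P vs) (map Q vs) = card {w \<in> set vs. P w \<and> \<not> Q w}"
  using assms
proof (induction vs)
  case (Cons v vs)
  have "{w \<in> set (v # vs). P w \<and> \<not> Q w} =
      (if P v \<and> \<not> Q v then insert v {w \<in> set vs. P w \<and> \<not> Q w} else {w \<in> set vs. P w \<and> \<not> Q w})"
    by auto
  then show ?case
    using Cons by (cases "P v"; cases "Q v") auto
qed simp

lemma full_rows_triangle:
  assumes "loopless G"
  shows "full_rows (triangle G vs) = map (\<lambda>u. map (adj G u) vs) vs"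
proof (induction vs)
  case (Cons v vs)
  have "\<not> adj G v v"
    using assms by (simp add: loopless_def)
  then show ?case
    using Cons by (simp add: zip_maps adj_commute)
qed simp

text \<open>The 2-switches that involve only vertices of a given set; the count is built up over growing sets.\<close>

definition switches_within :: "'a graph \<Rightarrow> 'a set \<Rightarrow> ('a set set \<times> 'a set set) set" where
  "switches_within X W = {({{a, b}, {x, y}}, {{a, x}, {b, y}}) | a b x y.
     switchable X a b x y \<and> {a, b, x, y} \<subseteq> W}"

lemma finite_two_switches:
  assumes "graph X"
  shows "finite (two_switches X)"
proof -
  have "two_switches X \<subseteq> (\<lambda>(a, b, x, y). ({{a, b}, {x, y}}, {{a, x}, {b, y}})) `
      (verts X \<times> verts X \<times> verts X \<times> verts X)"
  proof
    fix s assume "s \<in> two_switches X"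
    then obtain a b x y where "s = ({{a, b}, {x, y}}, {{a, x}, {b, y}})" "{a, b, x, y} \<subseteq> verts X"
      unfolding two_switches_def switchable_def by blast
    then show "s \<in> (\<lambda>(a, b, x, y). ({{a, b}, {x, y}}, {{a, x}, {b, y}})) `
        (verts X \<times> verts X \<times> verts X \<times> verts X)"
      by (intro image_eqI[of _ _ "(a, b, x, y)"]) auto
  qed
  moreover have "finite (verts X)"
    using assms by (simp add: graph_def)
  ultimately show ?thesis
    by (simp add: finite_subset)
qed

lemma switches_within_subset: "switches_within X W \<subseteq> two_switches X"
  unfolding switches_within_def two_switches_def by blast

text \<open>A 2-switch is an alternating 4-cycle, and those through the new vertex \<open>v\<close> are counted by the vertex
  \<open>x\<close> opposite to \<open>v\<close>. Distinct choices give distinct 2-switches because the deleted and the added edge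
  at \<open>v\<close> can be read off.\<close>

lemma switches_within_insert:
  assumes X: "graph X" and W: "finite W" "insert v W \<subseteq> verts X" "v \<notin> W"
  shows "card (switches_within X W) +
      (\<Sum>x\<in>W. card {a \<in> W. adj X v a \<and> \<not> adj X x a \<and> a \<noteq> x} * card {y \<in> W. adj X x y \<and> \<not> adj X v y})
    \<le> card (switches_within X (insert v W))"
proof -
  define A where "A x = {a \<in> W. adj X v a \<and> \<not> adj X x a \<and> a \<noteq> x}" for x
  define B where "B x = {y \<in> W. adj X x y \<and> \<not> adj X v y}" for x
  \<comment> \<open>An alternating 4-cycle through \<open>v\<close> is \<open>v, a, x, y\<close> with edges \<open>va\<close>, \<open>xy\<close> and non-edges \<open>ax\<close>, \<open>yv\<close>;
    its vertex \<open>x\<close> opposite to \<open>v\<close> determines the sets from which \<open>a\<close> and \<open>y\<close> are chosen.\<close>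
  define f where "f = (\<lambda>(x, a, y). ({{v, a}, {y, x}}, {{v, y}, {a, x}}))"
  let ?T = "Sigma W (\<lambda>x. A x \<times> B x)"
  have noloop: "\<not> adj X u u" for u
    using graph_loopless[OF X] by (simp add: loopless_def)
  have T: "card ?T = (\<Sum>x\<in>W. card (A x) * card (B x))"
    using W(1) by (simp add: A_def B_def card_cartesian_product)
  have inj: "inj_on f ?T"
    using W(3) by (auto simp: inj_on_def f_def A_def B_def doubleton_eq_iff)
  have sub: "f ` ?T \<subseteq> switches_within X (insert v W)"
  proof
    fix s assume "s \<in> f ` ?T"
    then obtain x a y where s: "s = ({{v, a}, {y, x}}, {{v, y}, {a, x}})" "x \<in> W" "a \<in> A x" "y \<in> B x"
      by (auto simp: f_def)
    then have "switchable X v a y x"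
      using W noloop unfolding switchable_def A_def B_def by (auto simp: insert_commute)
    moreover have "{v, a, y, x} \<subseteq> insert v W"
      using s by (auto simp: A_def B_def)
    ultimately show "s \<in> switches_within X (insert v W)"
      using s(1) unfolding switches_within_def by blast
  qed
  have disjoint: "switches_within X W \<inter> f ` ?T = {}"
  proof -
    have "v \<in> \<Union> (fst s)" if "s \<in> f ` ?T" for s
      using that by (auto simp: f_def)
    moreover have "v \<notin> \<Union> (fst s)" if "s \<in> switches_within X W" for s
      using that W(3) by (auto simp: switches_within_def)
    ultimately show ?thesis by blast
  qed
  have mono: "switches_within X W \<subseteq> switches_within X (insert v W)"
    unfolding switches_within_def by blast
  have fin: "finite (switches_within X U)" for U
    using finite_subset[OF switches_within_subset finite_two_switches[OF X]] .
  have "card (switches_within X W) + card (f ` ?T) = card (switches_within X W \<union> f ` ?T)"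
    using card_Un_disjoint[OF fin finite_subset[OF sub fin] disjoint] by simp
  also have "\<dots> \<le> card (switches_within X (insert v W))"
    using card_mono[OF fin] mono sub by (meson Un_least)
  finally show ?thesis
    unfolding card_image[OF inj] T by (simp only: A_def B_def)
qed

lemma switches_through_triangle:
  assumes "distinct vs" "v \<notin> set vs" "loopless X" "distinct us" "set us \<subseteq> set vs"
  shows "switches_through (map (adj X v) vs) (map (adj X v) us) (map (\<lambda>u. map (adj X u) vs) us) =
    (\<Sum>x\<in>set us. card {a \<in> set vs. adj X v a \<and> \<not> adj X x a \<and> a \<noteq> x} *
      card {y \<in> set vs. adj X x y \<and> \<not> adj X v y})"
  using assms(4,5)
proof (induction us)
  case (Cons x us)
  let ?A = "{a \<in> set vs. adj X v a \<and> \<not> adj X x a}"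
  have "\<not> adj X x x"
    using assms(3) by (simp add: loopless_def)
  then have A: "{a \<in> set vs. adj X v a \<and> \<not> adj X x a \<and> a \<noteq> x} = ?A - {x}" "x \<in> ?A \<longleftrightarrow> adj X v x"
    using Cons.prems by auto
  have "card {a \<in> set vs. adj X v a \<and> \<not> adj X x a \<and> a \<noteq> x} =
      (if adj X v x then card ?A - 1 else card ?A)"
    unfolding A(1) card_Diff_singleton_if A(2) ..
  then show ?case
    using Cons assms(1) by (cases "adj X v x") (simp_all add: excess_map)
qed simp

lemma switches_triangle:
  assumes "graph X" "distinct vs" "set vs \<subseteq> verts X"
  shows "switches (triangle X vs) \<le> card (switches_within X (set vs))"
  using assms(2,3)
proof (induction vs)
  case (Cons v vs)
  then show ?case
    using switches_within_insert[OF assms(1), of "set vs" v] graph_loopless[OF assms(1)]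
      switches_through_triangle[of vs v X vs]
    by (simp add: full_rows_triangle)
qed simp

text \<open>An induced subgraph with more than four 2-switches therefore excludes a graph from consideration.\<close>

corollary switches_le_degree:
  assumes "graph X" "distinct vs" "set vs \<subseteq> verts X"
  shows "switches (triangle X vs) \<le> two_switch_degree X"
  using switches_triangle[OF assms] card_mono[OF finite_two_switches[OF assms(1)] switches_within_subset]
  unfolding two_switch_degree_def by (meson le_trans)


section \<open>Growing indecomposable induced subgraphs\<close>

text \<open>If the earlier vertex lies on side \<open>b\<close> (\<open>True\<close> for the clique), it must be adjacent to the later vertices
  of the same side when \<open>b\<close> is true, and to none of them when \<open>b\<close> is false.\<close>

fun split_row :: "bool \<Rightarrow> bool list \<Rightarrow> bool list \<Rightarrow> bool" where
  "split_row b (x # r) (c # k) \<longleftrightarrow> (c = b \<longrightarrow> x = b) \<and> split_row b r k"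
| "split_row b _ _ \<longleftrightarrow> True"

text \<open>Whether the word \<open>k\<close> is the indicator of the clique in a split partition.\<close>

fun split_word :: "bool list list \<Rightarrow> bool list \<Rightarrow> bool" where
  "split_word (r # M) (b # k) \<longleftrightarrow> split_row b r k \<and> split_word M k"
| "split_word _ _ \<longleftrightarrow> True"

text \<open>The three ways in which a vertex can be added to a nonempty graph so that it or the rest splits off as the
  outer factor of a composition: an isolated vertex, a dominating vertex, or a vertex joined exactly
  to the clique of a split partition.\<close>

definition trivial_row :: "bool list list \<Rightarrow> bool list \<Rightarrow> bool" where
  "trivial_row M r \<longleftrightarrow> list_all Not r \<or> list_all id r \<or> split_word M r"

text \<open>Two trivial outside vertices can still obstruct every decomposition. An isolated vertex must have no
  neighbour outside other than dominating ones, a dominating vertex must be adjacent to every outside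
  vertex that is not isolated, and vertices attached to split partitions must agree. The relation is
  stated from the side of the first vertex; both orders of a pair are inspected.\<close>

definition clashing :: "bool list \<Rightarrow> bool list \<Rightarrow> bool \<Rightarrow> bool" where
  "clashing r s b \<longleftrightarrow> (list_all Not r \<and> \<not> list_all id s \<and> b) \<or>
     (list_all id r \<and> \<not> list_all Not s \<and> \<not> b) \<or>
     (list_ex Not r \<and> list_ex id r \<and> list_ex Not s \<and> list_ex id s \<and> r \<noteq> s)"

text \<open>The subgraph induced by \<open>K \<union> I\<close> splits off as the outer factor.\<close>

lemma decomposableI:
  assumes X: "graph X" and V: "verts X = K \<union> I \<union> R" "K \<inter> I = {}" "(K \<union> I) \<inter> R = {}"
    and ne: "K \<union> I \<noteq> {}" "R \<noteq> {}"
    and clique: "\<And>u v. u \<in> K \<Longrightarrow> v \<in> K \<Longrightarrow> u \<noteq> v \<Longrightarrow> adj X u v"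
    and independent: "\<And>u v. u \<in> I \<Longrightarrow> v \<in> I \<Longrightarrow> \<not> adj X u v"
    and full: "\<And>u v. u \<in> K \<Longrightarrow> v \<in> R \<Longrightarrow> adj X u v"
    and null: "\<And>u v. u \<in> I \<Longrightarrow> v \<in> R \<Longrightarrow> \<not> adj X u v"
  shows "decomposable X"
proof -
  define S where "S = (K \<union> I, edges X \<inter> all_edges (K \<union> I))"
  define H where "H = (R, edges X \<inter> all_edges R)"
  have fin: "finite (verts X)"
    using X by (simp add: graph_def)
  have "graph S" "graph H"
    using fin V(1) ne by (auto simp: S_def H_def graph_def)
  moreover have "split_partition S K I"
    using V(2) clique independent by (auto simp: split_partition_def S_def all_edges_def)
  moreover have "card (verts S) \<ge> 1" "card (verts H) \<ge> 1"
    using fin ne unfolding V(1) S_def H_def by (auto simp: Suc_le_eq card_gt_0_iff)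
  moreover have "X = tyshkevich_comp S K H"
  proof -
    have "e \<in> edges (tyshkevich_comp S K H)" if e: "e \<in> edges X" for e
    proof -
      obtain u v where uv: "e = {u, v}" "u \<in> verts X" "v \<in> verts X" "u \<noteq> v"
        using graph_edgeE[OF X e] .
      have cross: "e \<in> edges (tyshkevich_comp S K H)" if "p \<in> K \<union> I" "q \<in> R" "e = {p, q}" for p q
        using that null[of p q] e by (auto simp: tyshkevich_comp_def H_def)
      consider "u \<in> K \<union> I" "v \<in> K \<union> I" | "u \<in> R" "v \<in> R" | "u \<in> K \<union> I" "v \<in> R" | "v \<in> K \<union> I" "u \<in> R"
        using uv V(1) by blast
      then show ?thesis
      proof cases
        case 1
        then show ?thesis
          using uv e by (auto simp: tyshkevich_comp_def S_def all_edges_def)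
      next
        case 2
        then show ?thesis
          using uv e by (auto simp: tyshkevich_comp_def H_def all_edges_def)
      qed (use cross[of u v] cross[of v u] uv(1) in \<open>auto simp: insert_commute\<close>)
    qed
    moreover have "edges (tyshkevich_comp S K H) \<subseteq> edges X"
      using full by (auto simp: tyshkevich_comp_def S_def H_def)
    moreover have "verts X = verts (tyshkevich_comp S K H)"
      using V(1) by (simp add: tyshkevich_comp_def S_def H_def)
    ultimately show ?thesis
      by (auto simp: prod_eq_iff)
  qed
  moreover have "verts S \<inter> verts H = {}"
    using V(3) by (simp add: S_def H_def)
  ultimately show ?thesis
    unfolding decomposable_def by blast
qed

lemma split_row_map:
  "split_row b (map P vs) (map Q vs) \<longleftrightarrow> (\<forall>u\<in>set vs. Q u = b \<longrightarrow> P u = b)"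
  by (induction vs) auto

lemma split_word_triangle:
  assumes "split_word (triangle G vs) (map Q vs)" "u \<in> set vs" "w \<in> set vs" "u \<noteq> w" "Q u = Q w"
  shows "adj G u w = Q u"
  using assms
proof (induction vs)
  case (Cons v vs)
  then have v: "adj G v z = Q v" if "z \<in> set vs" "Q z = Q v" for z
    using that by (auto simp: split_row_map)
  consider "u = v" "w \<in> set vs" | "w = v" "u \<in> set vs" | "u \<in> set vs" "w \<in> set vs"
    using Cons.prems by auto
  then show ?case
  proof cases
    case 1
    then show ?thesis using v[of w] Cons.prems by simp
  next
    case 2
    then show ?thesis using v[of u] Cons.prems by (simp add: adj_commute)
  next
    case 3
    then show ?thesis using Cons by simp
  qed
qed simp

text \<open>The structural heart of the classification: an indecomposable graph that properly contains \<open>vs\<close> has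
  a nontrivial vertex outside \<open>vs\<close> or a clashing pair, so induced subgraphs can be grown by one or two
  vertices. Pairs are really needed: the graph of \<open>T_111\<close> contains \<open>P4\<close>, but each further vertex is
  trivial for it.\<close>

lemma trivial_outside_imp_decomposable:
  assumes X: "graph X" and vs: "distinct vs" "vs \<noteq> []" "set vs \<subseteq> verts X" "set vs \<noteq> verts X"
    and trivial: "\<And>v. v \<in> verts X - set vs \<Longrightarrow> trivial_row (triangle X vs) (map (adj X v) vs)"
    and agree: "\<And>u v. u \<in> verts X - set vs \<Longrightarrow> v \<in> verts X - set vs \<Longrightarrow> u \<noteq> v \<Longrightarrow>
      \<not> clashing (map (adj X u) vs) (map (adj X v) vs) (adj X u v)"
  shows "decomposable X"
proof -
  define Out where "Out = verts X - set vs"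
  define null where "null v \<longleftrightarrow> (\<forall>w\<in>set vs. \<not> adj X v w)" for v
  define full where "full v \<longleftrightarrow> (\<forall>w\<in>set vs. adj X v w)" for v
  have not_both: "\<not> (null v \<and> full v)" for v
    using vs(2) by (cases vs) (auto simp: null_def full_def)
  have rows: "list_all Not (map (adj X v) vs) \<longleftrightarrow> null v" "list_all id (map (adj X v) vs) \<longleftrightarrow> full v"
      "list_ex Not (map (adj X v) vs) \<longleftrightarrow> \<not> full v" "list_ex id (map (adj X v) vs) \<longleftrightarrow> \<not> null v" for v
    by (auto simp: null_def full_def list_all_iff list_ex_iff)
  have clash: "\<not> (null u \<and> \<not> full v \<and> adj X u v)" "\<not> (full u \<and> \<not> null v \<and> \<not> adj X u v)"
      "\<not> null u \<Longrightarrow> \<not> full u \<Longrightarrow> \<not> null v \<Longrightarrow> \<not> full v \<Longrightarrow> map (adj X u) vs = map (adj X v) vs"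
    if "u \<in> Out" "v \<in> Out" "u \<noteq> v" for u v
    using agree[of u v] that unfolding clashing_def rows Out_def by blast+
  show ?thesis
  proof (cases "\<exists>v\<in>Out. null v \<or> full v")
    case True
    \<comment> \<open>The null and full vertices form the outer split factor: they cannot distinguish
      the vertices of \<open>vs\<close>, nor, by the absence of clashes, the remaining outside vertices.\<close>
    let ?K = "{v \<in> Out. full v}" and ?I = "{v \<in> Out. null v}" and ?R = "set vs \<union> {v \<in> Out. \<not> null v \<and> \<not> full v}"
    show ?thesis
    proof (rule decomposableI[OF X, of ?K ?I ?R])
      show "verts X = ?K \<union> ?I \<union> ?R"
        using vs(3) by (auto simp: Out_def)
      show "?K \<inter> ?I = {}" "(?K \<union> ?I) \<inter> ?R = {}" "?K \<union> ?I \<noteq> {}" "?R \<noteq> {}"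
        using not_both True vs(2) by (auto simp: Out_def)
    next
      fix u v assume "u \<in> ?K" "v \<in> ?K" "u \<noteq> v"
      then show "adj X u v" using clash(2)[of u v] not_both by blast
    next
      fix u v assume "u \<in> ?I" "v \<in> ?I"
      then show "\<not> adj X u v"
        using clash(1)[of u v] not_both graph_adjD[OF X, of u v] by blast
    next
      fix u v assume u: "u \<in> ?K" and v: "v \<in> ?R"
      then show "adj X u v"
        using clash(2)[of u v] not_both[of u] by (auto simp: full_def)
    next
      fix u v assume u: "u \<in> ?I" and v: "v \<in> ?R"
      then show "\<not> adj X u v"
        using clash(1)[of u v] not_both[of u] by (auto simp: null_def)
    qed
  next
    case False
    \<comment> \<open>All outside vertices see the same split partition of \<open>vs\<close>, so \<open>vs\<close> itself is the
      outer split factor.\<close>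
    obtain o0 where o0: "o0 \<in> Out"
      using vs(3,4) by (auto simp: Out_def)
    define Q where "Q = adj X o0"
    have rest: "adj X v w = Q w" if "v \<in> Out" "w \<in> set vs" for v w
    proof -
      have "map (adj X v) vs = map Q vs"
        using clash(3)[of v o0] that o0 False unfolding Q_def by (cases "v = o0") auto
      then show ?thesis
        using that(2) by simp
    qed
    have split: "split_word (triangle X vs) (map Q vs)"
      using trivial[of o0] o0 False unfolding trivial_row_def rows Q_def Out_def by blast
    let ?K = "{w \<in> set vs. Q w}" and ?I = "{w \<in> set vs. \<not> Q w}"
    show ?thesis
    proof (rule decomposableI[OF X, of ?K ?I Out])
      show "verts X = ?K \<union> ?I \<union> Out"
        using vs(3) by (auto simp: Out_def)
      show "?K \<inter> ?I = {}" "(?K \<union> ?I) \<inter> Out = {}" "Out \<noteq> {}"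
        using o0 by (auto simp: Out_def)
      show "?K \<union> ?I \<noteq> {}"
        using vs(2) by (cases vs) auto
    next
      fix u v assume "u \<in> ?K" "v \<in> ?K" "u \<noteq> v"
      then show "adj X u v"
        using split_word_triangle[OF split, of u v] by auto
    next
      fix u v assume "u \<in> ?I" "v \<in> ?I"
      then show "\<not> adj X u v"
        using split_word_triangle[OF split, of u v] graph_adjD[OF X, of u v] by auto
    next
      fix u v assume "u \<in> ?K" "v \<in> Out"
      then show "adj X u v"
        using rest[of v u] by (simp add: adj_commute)
    next
      fix u v assume "u \<in> ?I" "v \<in> Out"
      then show "\<not> adj X u v"
        using rest[of v u] by (simp add: adj_commute)
    qed
  qed
qed

fun words :: "nat \<Rightarrow> bool list list" where
  "words 0 = [[]]"
| "words (Suc n) = map ((#) True) (words n) @ map ((#) False) (words n)"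

lemma set_words: "set (words n) = {r. length r = n}"
proof (induction n)
  case (Suc n)
  have "r \<in> set (words (Suc n)) \<longleftrightarrow> length r = Suc n" for r
    using Suc by (cases r; cases "hd r") auto
  then show ?case by auto
qed auto

text \<open>The branch ends here, because of too many 2-switches, or leads to a graph that is listed in \<open>L\<close>.\<close>

definition accepted :: "bool list list list \<Rightarrow> bool list list \<Rightarrow> bool" where
  "accepted L N \<longleftrightarrow> 4 < switches N \<or> list_ex (same_graph N) L"

definition row_accepted :: "bool list list list \<Rightarrow> bool list list \<Rightarrow> bool list \<Rightarrow> bool" where
  "row_accepted L M r \<longleftrightarrow> trivial_row M r \<or> accepted L (r # M)"

fun pair_accepted :: "bool list list list \<Rightarrow> bool list list \<Rightarrow> bool list \<times> bool list \<times> bool \<Rightarrow> bool" where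
  "pair_accepted L M (r, s, b) \<longleftrightarrow> \<not> clashing r s b \<or> accepted L ((b # r) # s # M)"

definition pairs_accepted ::
    "bool list list list \<Rightarrow> bool list list \<Rightarrow> bool list list \<Rightarrow> bool" where
  "pairs_accepted L M T \<longleftrightarrow>
     list_all (pair_accepted L M) (List.product T (List.product T [True, False]))"

definition extensions_accepted :: "bool list list list \<Rightarrow> bool list list \<Rightarrow> bool" where
  "extensions_accepted L M \<longleftrightarrow>
     list_all (row_accepted L M) (words (length M)) \<and>
     pairs_accepted L M (filter (trivial_row M) (words (length M)))"

definition closed_under_extension :: "bool list list list \<Rightarrow> bool" where
  "closed_under_extension L \<longleftrightarrow> list_all (extensions_accepted L) L"

text \<open>A list that is closed under the two kinds of growth contains every indecomposable graph with at most
  four 2-switches that has an induced subgraph in the list.\<close>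

theorem indecomposable_has_catalogued_triangle:
  assumes X: "graph X" "\<not> decomposable X" "two_switch_degree X \<le> 4"
    and L: "closed_under_extension L" "[] \<notin> set L"
    and start: "distinct vs0" "set vs0 \<subseteq> verts X" "triangle X vs0 \<in> set L"
  shows "\<exists>M\<in>set L. has_triangle X M"
proof -
  define good where "good vs \<longleftrightarrow> distinct vs \<and> set vs \<subseteq> verts X \<and> triangle X vs \<in> set L" for vs
  have "length vs < Suc (card (verts X))" if "good vs" for vs
    using that X(1) card_mono[of "verts X" "set vs"] distinct_card[of vs]
    by (auto simp: good_def graph_def less_Suc_eq_le)
  \<comment> \<open>A longest catalogued vertex list exhausts the graph: otherwise the closure of \<open>L\<close> leaves
    only trivial and non-clashing outside vertices.\<close>
  then obtain vs where vs: "good vs" "\<And>us. good us \<Longrightarrow> length us \<le> length vs"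
    using ex_has_greatest_nat[of good vs0 length] start unfolding good_def by blast
  then have vsd: "distinct vs" "set vs \<subseteq> verts X" "triangle X vs \<in> set L"
    by (auto simp: good_def)
  have "set vs = verts X"
  proof (rule ccontr)
    assume ne: "set vs \<noteq> verts X"
    have acc: False if us: "accepted L (triangle X us)" "distinct us" "set us \<subseteq> verts X" "length vs < length us" for us
    proof -
      have "\<not> 4 < switches (triangle X us)"
        using switches_le_degree[OF X(1) us(2,3)] X(3) by simp
      then obtain M where M: "M \<in> set L" "same_graph (triangle X us) M"
        using us(1) by (auto simp: accepted_def list_ex_iff)
      obtain ws where "distinct ws" "set ws = set us" "triangle X ws = M"
        using same_graph_sound[OF M(2) us(2)] by blast
      then have "good ws" "length ws = length us"
        using M(1) us(2,3) distinct_card[of ws] distinct_card[of us] by (auto simp: good_def)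
      then show False
        using vs(2)[of ws] us(4) by simp
    qed
    have ext: "extensions_accepted L (triangle X vs)"
      using L(1) vsd(3) by (auto simp: closed_under_extension_def list_all_iff)
    have "decomposable X"
    proof (rule trivial_outside_imp_decomposable[OF X(1) vsd(1) _ vsd(2) ne])
      show "vs \<noteq> []"
        using vsd(3) L(2) by auto
      show triv: "trivial_row (triangle X vs) (map (adj X v) vs)" if v: "v \<in> verts X - set vs" for v
      proof -
        have "row_accepted L (triangle X vs) (map (adj X v) vs)"
          using ext by (auto simp: extensions_accepted_def list_all_iff set_words)
        then show ?thesis
          using acc[of "v # vs"] v vsd by (auto simp: row_accepted_def)
      qed
      fix u v assume uv: "u \<in> verts X - set vs" "v \<in> verts X - set vs" "u \<noteq> v"
      have "pair_accepted L (triangle X vs) (map (adj X u) vs, map (adj X v) vs, adj X u v)"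
        using ext triv[OF uv(1)] triv[OF uv(2)]
        by (cases "adj X u v")
          (auto simp: extensions_accepted_def pairs_accepted_def list_all_iff set_words)
      then show "\<not> clashing (map (adj X u) vs) (map (adj X v) vs) (adj X u v)"
        using acc[of "u # v # vs"] uv vsd by auto
    qed
    then show False
      using X(2) by simp
  qed
  then show ?thesis
    using vsd graph_loopless[OF X(1)] by (auto simp: has_triangle_def)
qed


section \<open>Triangles of the named graphs\<close>

definition clique_triangle :: "nat \<Rightarrow> bool list list" where
  "clique_triangle n = triangle_of (\<lambda>_ _. True) [0..<n]"

definition edge_triangle :: "nat list \<Rightarrow> (nat \<times> nat) list \<Rightarrow> bool list list" where
  "edge_triangle vs es = triangle_of (\<lambda>u v. (u, v) \<in> set es \<or> (v, u) \<in> set es) vs"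

definition multipartite_triangle :: "nat list \<Rightarrow> bool list list" where
  "multipartite_triangle ns = triangle_of (\<lambda>u v. fst u \<noteq> fst v)
     (concat (map (\<lambda>i. map (Pair i) [0..<ns ! i]) [0..<length ns]))"

fun split_adj :: "nat list list \<Rightarrow> split_vertex \<Rightarrow> split_vertex \<Rightarrow> bool" where
  "split_adj Ns (Clq i) (Clq j) \<longleftrightarrow> True"
| "split_adj Ns (Ind m) (Clq i) \<longleftrightarrow> i \<in> set (Ns ! m)"
| "split_adj Ns (Clq i) (Ind m) \<longleftrightarrow> i \<in> set (Ns ! m)"
| "split_adj Ns (Ind m) (Ind n) \<longleftrightarrow> False"

text \<open>The independent vertices are listed before the clique.\<close>

definition split_triangle :: "nat \<Rightarrow> nat list list \<Rightarrow> bool list list" where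
  "split_triangle k Ns =
     triangle_of (split_adj Ns) (map Ind [0..<length Ns] @ map Clq [1..<Suc k])"

definition P4_triangle :: "bool list list" where
  "P4_triangle = edge_triangle [0, 1, 2, 3] [(0, 1), (1, 2), (2, 3)]"

definition C4_triangle :: "bool list list" where
  "C4_triangle = edge_triangle [0, 1, 2, 3] [(0, 1), (1, 2), (2, 3), (3, 0)]"

definition B_triangle :: "nat \<Rightarrow> bool list list" where
  "B_triangle j = edge_triangle [4, 0, 1, 2, 3]
     ([(0, 1), (1, 2), (2, 3), (3, 0)] @ map (Pair 4) [0..<j])"

definition G1_triangle :: "bool list list" where
  "G1_triangle = edge_triangle [0, 1, 2, 3, 4, 5, 6]
     ([(1, 2), (2, 3), (3, 4), (4, 5), (5, 6), (6, 1)] @ map (Pair 0) [1..<7] @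
      [(1, 3), (4, 6), (2, 5)])"

definition G2_triangle :: "bool list list" where
  "G2_triangle = edge_triangle [1, 2, 3, 4, 5, 6, 7, 8]
     ([(1, 2), (2, 3), (3, 4), (4, 1)] @ [(5, 6), (5, 7), (5, 8), (6, 7), (6, 8), (7, 8)] @
      [(1, 5), (2, 5), (2, 6), (3, 6), (3, 7), (4, 7), (4, 8), (1, 8)])"

definition D_triangle :: "nat \<Rightarrow> nat \<Rightarrow> bool list list" where
  "D_triangle p q = split_triangle (p + q) [[1..<Suc q], [q + 1..<Suc (p + q)]]"

definition T_111_triangle :: "bool list list" where
  "T_111_triangle = split_triangle 3 [[1], [2], [3]]"

definition T_221_triangle :: "bool list list" where
  "T_221_triangle = split_triangle 3 [[2], [1, 3], [2, 3]]"

definition R_211_triangle :: "bool list list" where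
  "R_211_triangle = split_triangle 3 [[1], [2, 3], [1]]"

definition R_311_triangle :: "bool list list" where
  "R_311_triangle = split_triangle 4 [[1], [2], [1, 3, 4]]"

definition R_331_triangle :: "bool list list" where
  "R_331_triangle = split_triangle 4 [[1], [2, 3, 4], [1, 3, 4]]"

definition R_321_triangle :: "bool list list" where
  "R_321_triangle = split_triangle 4 [[1], [2, 3], [1, 3, 4]]"

lemma has_triangle_split_graph:
  "has_triangle (split_graph k (map set Ns)) (split_triangle k Ns)"
proof -
  let ?G = "split_graph k (map set Ns)" and ?vs = "map Ind [0..<length Ns] @ map Clq [1..<Suc k]"
  have verts: "set ?vs = verts ?G"
    by (auto simp: split_graph_def)
  have adj: "adj ?G u v \<longleftrightarrow> split_adj Ns u v" if "u \<in> set ?vs" "v \<in> set ?vs" "u \<noteq> v" for u v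
    using that unfolding verts
    by (cases u; cases v)
      (auto simp: split_graph_def doubleton_in_all_edges doubleton_eq_iff all_edges_def)
  have "loopless ?G"
    by (auto simp: loopless_def split_graph_def all_edges_def doubleton_eq_iff)
  moreover have "distinct ?vs"
    by (auto simp: distinct_map inj_on_def)
  ultimately show ?thesis
    using verts triangle_eq_triangle_of[OF _ adj] unfolding split_triangle_def
    by (intro has_triangleI)
qed

lemma named_split_graphs:
  "has_triangle (D_graph p q) (D_triangle p q)"
  "has_triangle T_111 T_111_triangle"
  "has_triangle T_221 T_221_triangle"
  "has_triangle R_211 R_211_triangle"
  "has_triangle R_311 R_311_triangle"
  "has_triangle R_331 R_331_triangle"
  "has_triangle R_321 R_321_triangle"
proof -
  have "{1..q} = set [1..<Suc q]" "{q + 1..p + q} = set [q + 1..<Suc (p + q)]"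
    by auto
  then show "has_triangle (D_graph p q) (D_triangle p q)"
    using has_triangle_split_graph[of "p + q" "[[1..<Suc q], [q + 1..<Suc (p + q)]]"]
    unfolding D_graph_def D_triangle_def by (simp del: upt_Suc)
qed (use has_triangle_split_graph[of 3 "[[1], [2], [3]]"]
    has_triangle_split_graph[of 3 "[[2], [1, 3], [2, 3]]"]
    has_triangle_split_graph[of 3 "[[1], [2, 3], [1]]"]
    has_triangle_split_graph[of 4 "[[1], [2], [1, 3, 4]]"]
    has_triangle_split_graph[of 4 "[[1], [2, 3, 4], [1, 3, 4]]"]
    has_triangle_split_graph[of 4 "[[1], [2, 3], [1, 3, 4]]"]
    in \<open>simp_all add: T_111_def T_111_triangle_def T_221_def T_221_triangle_def R_211_def
      R_211_triangle_def R_311_def R_311_triangle_def R_331_def R_331_triangle_def R_321_def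
      R_321_triangle_def\<close>)

lemma has_triangle_edge_list:
  assumes "distinct vs" "set vs = verts G" "edges G = (\<lambda>(u, v). {u, v}) ` set es"
    "\<And>u. (u, u) \<notin> set es"
  shows "has_triangle G (edge_triangle vs es)"
proof -
  have adj: "adj G u v \<longleftrightarrow> (u, v) \<in> set es \<or> (v, u) \<in> set es" for u v
    unfolding assms(3) by (force simp: doubleton_eq_iff)
  then have "loopless G"
    using assms(4) unfolding loopless_def by blast
  then show ?thesis
    using assms(1,2) triangle_eq_triangle_of[OF assms(1) adj] unfolding edge_triangle_def
    by (intro has_triangleI)
qed

text \<open>The complement of the cycle \<open>0, 1, 2, 3\<close> has the edges \<open>02\<close> and \<open>13\<close>, hence the order \<open>0, 2, 1, 3\<close> for \<open>2K\<^sub>2\<close>.\<close>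

lemma small_named_graphs:
  "has_triangle P4 P4_triangle"
  "has_triangle C4 C4_triangle"
  "has_triangle two_K2 (co_triangle C4_triangle)"
proof -
  show "has_triangle P4 P4_triangle" "has_triangle C4 C4_triangle"
    unfolding P4_triangle_def C4_triangle_def
    by (rule has_triangle_edge_list; force simp: P4_def C4_def)+
  have "has_triangle two_K2 (edge_triangle [0, 2, 1, 3] [(0, 1), (2, 3)])"
    by (rule has_triangle_edge_list) (auto simp: two_K2_def)
  moreover have "edge_triangle [0, 2, 1, 3] [(0, 1), (2, 3)] = co_triangle C4_triangle"
    by code_simp
  ultimately show "has_triangle two_K2 (co_triangle C4_triangle)"
    by simp
qed

lemma has_triangle_B_graph: "j \<le> 4 \<Longrightarrow> has_triangle (B_graph j) (B_triangle j)"
  unfolding B_triangle_def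
proof (rule has_triangle_edge_list)
  have "{{4, i} | i. i < j} = (\<lambda>(u, v). {u, v}) ` set (map (Pair 4) [0..<j])"
    by (auto simp: image_iff)
  then show "edges (B_graph j) = (\<lambda>(u, v). {u, v}) `
      set ([(0, 1), (1, 2), (2, 3), (3, 0)] @ map (Pair 4) [0..<j])"
    unfolding B_graph_def C4_def by (simp only: set_append image_Un) simp
qed (auto simp: B_graph_def C4_def)

lemma has_triangle_complete_graph: "has_triangle (complete_graph n) (clique_triangle n)"
proof (rule has_triangleI[of _ "[0..<n]"])
  show "triangle (complete_graph n) [0..<n] = clique_triangle n"
    unfolding clique_triangle_def
    by (rule triangle_eq_triangle_of) (auto simp: complete_graph_def doubleton_in_all_edges)
qed (auto simp: complete_graph_def all_edges_def loopless_def doubleton_eq_iff)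

lemma has_triangle_complete_multipartite:
  "has_triangle (complete_multipartite ns) (multipartite_triangle ns)"
proof -
  let ?vs = "concat (map (\<lambda>i. map (Pair i) [0..<ns ! i]) [0..<length ns])"
  have verts: "set ?vs = verts (complete_multipartite ns)"
    by (auto simp: complete_multipartite_def)
  have adj: "adj (complete_multipartite ns) u v \<longleftrightarrow> fst u \<noteq> fst v"
    if "u \<in> set ?vs" "v \<in> set ?vs" "u \<noteq> v" for u v
  proof -
    have "edges (complete_multipartite ns) = {{u, v} | u v. u \<in> set ?vs \<and> v \<in> set ?vs \<and> fst u \<noteq> fst v}"
      unfolding verts by (simp add: complete_multipartite_def Let_def)
    with that show ?thesis
      by (simp only: mem_Collect_eq doubleton_eq_iff) metis
  qed
  have "distinct (concat (map (\<lambda>i. map (Pair i) (f i)) is))"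
    if "\<And>i. distinct (f i)" "distinct is" for f :: "nat \<Rightarrow> nat list" and "is" :: "nat list"
    using that(2) by (induction "is") (auto simp: distinct_map inj_on_def that(1))
  then have "distinct ?vs" by auto
  moreover have "loopless (complete_multipartite ns)"
    by (auto simp: loopless_def complete_multipartite_def Let_def doubleton_eq_iff)
  ultimately show ?thesis
    using verts triangle_eq_triangle_of[OF _ adj] unfolding multipartite_triangle_def
    by (intro has_triangleI)
qed

lemma has_triangle_calG:
  "has_triangle calG1 G1_triangle"
  "has_triangle calG2 G2_triangle"
proof -
  show "has_triangle calG1 G1_triangle"
    unfolding G1_triangle_def
  proof (rule has_triangle_edge_list)
    show "edges calG1 = (\<lambda>(u, v). {u, v}) ` set ([(1, 2), (2, 3), (3, 4), (4, 5), (5, 6), (6, 1)] @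
        map (Pair 0) [1..<7] @ [(1, 3), (4, 6), (2, 5)])"
    proof -
      have "{{0, i} | i. i \<in> {1..6}} = (\<lambda>(u, v). {u, v}) ` set (map (Pair 0) [1..<7::nat])"
        by (auto simp: image_iff)
      then show ?thesis
        unfolding calG1_def by (simp only: set_append image_Un Un_assoc) simp
    qed
  qed (auto simp: calG1_def)
  have "all_edges {5, 6, 7, 8 :: nat} = {{5, 6}, {5, 7}, {5, 8}, {6, 7}, {6, 8}, {7, 8}}"
    by (auto simp: all_edges_insert all_edges_def[of "{}"] insert_Diff_if insert_commute)
  then have "edges calG2 = (\<lambda>(u, v). {u, v}) ` set ([(1, 2), (2, 3), (3, 4), (4, 1)] @
      [(5, 6), (5, 7), (5, 8), (6, 7), (6, 8), (7, 8)] @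
      [(1, 5), (2, 5), (2, 6), (3, 6), (3, 7), (4, 7), (4, 8), (1, 8)])"
    unfolding calG2_def by (simp only: set_append image_Un Un_assoc snd_conv) simp
  moreover have "set [1, 2, 3, 4, 5, 6, 7, 8] = verts calG2"
    by (auto simp: calG2_def)
  ultimately show "has_triangle calG2 G2_triangle"
    unfolding G2_triangle_def by (intro has_triangle_edge_list) simp_all
qed


section \<open>Prime graphs with at most four 2-switches\<close>

text \<open>Representatives up to complement; \<open>P4\<close> is left to the full catalogue since it is isomorphic to its own
  complement. The complement of \<open>C4\<close> is \<open>2K\<^sub>2\<close>.\<close>

definition base :: "bool list list list" where
  "base = [C4_triangle, D_triangle 2 1, D_triangle 3 1, T_111_triangle, T_221_triangle,
    R_211_triangle, D_triangle 4 1, D_triangle 2 2, B_triangle 1, B_triangle 3, B_triangle 2,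
    R_311_triangle, R_331_triangle, R_321_triangle]"

definition catalogue :: "bool list list list" where
  "catalogue = P4_triangle # base @ map co_triangle base"

text \<open>The finite search: every nontrivial one-vertex extension and every clashing two-vertex extension of
  one of the 29 graphs has more than four 2-switches or is isomorphic to one of the 29 graphs. The
  growth stops at seven vertices.\<close>

lemma catalogue_closed: "closed_under_extension catalogue"
  by code_simp

text \<open>The vertices of a single 2-switch induce one of these three graphs, according to the two adjacencies
  that the 2-switch leaves open.\<close>

lemma prime_start:
  assumes "graph X" "prime_graph X"
  shows "\<exists>vs. distinct vs \<and> set vs \<subseteq> verts X \<and>
    triangle X vs \<in> {P4_triangle, C4_triangle, co_triangle C4_triangle}"
proof -
  have "verts X \<noteq> {}"
    using assms(1) by (simp add: graph_def)
  then obtain a b x y where s: "switchable X a b x y"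
    using assms(2) unfolding prime_graph_def active_graph_def active_vertex_def by fast
  have sym: "adj X u v \<longleftrightarrow> adj X v u" for u v
    by (rule adj_commute)
  have P4: "P4_triangle = [[True, False, False], [True, False], [True], []]"
    and C4: "C4_triangle = [[True, False, True], [True, False], [True], []]"
    and two_K2: "co_triangle C4_triangle = [[False, True, False], [False, True], [False], []]"
    by code_simp+
  have e: "adj X a b" "adj X b a" "adj X x y" "adj X y x" "\<not> adj X a x" "\<not> adj X x a" "\<not> adj X b y" "\<not> adj X y b"
    and V: "{a, b, x, y} \<subseteq> verts X" "distinct [a, b, x, y]"
    using s sym unfolding switchable_def by blast+
  consider "adj X a y" "adj X b x" | "\<not> adj X a y" "adj X b x" | "adj X a y" "\<not> adj X b x" | "\<not> adj X a y" "\<not> adj X b x"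
    by blast
  then show ?thesis
  proof cases
    case 1
    then show ?thesis
      using e V unfolding C4 by (intro exI[of _ "[a, b, x, y]"]) simp
  next
    case 2
    then show ?thesis
      using e V unfolding P4 by (intro exI[of _ "[a, b, x, y]"]) simp
  next
    case 3
    then show ?thesis
      using e V unfolding P4 by (intro exI[of _ "[b, a, y, x]"]) auto
  next
    case 4
    then show ?thesis
      using e V sym[of x b] unfolding two_K2 by (intro exI[of _ "[a, x, b, y]"]) auto
  qed
qed

text \<open>Complementation preserves realization graphs, so a graph and its complement share the target.\<close>

definition both_realize :: "bool list list \<Rightarrow> bool list list \<Rightarrow> bool" where
  "both_realize M N \<longleftrightarrow> same_graph (realization_triangle M) N \<and>
     same_graph (realization_triangle (co_triangle M)) N"

lemma both_realize_iso:
  assumes "graph X" "has_triangle T N" "both_realize M N"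
    and "has_triangle X M \<or> has_triangle X (co_triangle M)"
  shows "realization_graph X \<approx> T"
  using assms realization_graph_has_triangle has_triangle_same_graph has_triangle_imp_iso
  unfolding both_realize_def by metis

text \<open>Each entry enumerates the at most eight realizations of the graph and of its complement and searches
  for an isomorphism onto the target.\<close>

lemma realization_table:
  "both_realize P4_triangle (clique_triangle 2)"
  "both_realize C4_triangle (clique_triangle 3)"
  "both_realize (D_triangle 2 1) (clique_triangle 3)"
  "both_realize (D_triangle 3 1) (clique_triangle 4)"
  "both_realize T_111_triangle (multipartite_triangle [3, 3])"
  "both_realize T_221_triangle (multipartite_triangle [1, 2, 2])"
  "both_realize R_211_triangle (multipartite_triangle [1, 2, 2])"
  "both_realize (D_triangle 4 1) (clique_triangle 5)"
  "both_realize (D_triangle 2 2) (multipartite_triangle [2, 2, 2])"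
  "both_realize (B_triangle 1) (multipartite_triangle [2, 2, 2])"
  "both_realize (B_triangle 3) (multipartite_triangle [2, 2, 2])"
  "both_realize (B_triangle 2) (multipartite_triangle [1, 3, 3])"
  "both_realize R_311_triangle G1_triangle"
  "both_realize R_331_triangle G1_triangle"
  "both_realize R_321_triangle G2_triangle"
  by code_simp+

lemma realization_graph_iso:
  assumes "graph X" "has_triangle T N" "both_realize M N" "has_triangle G M"
    and "X \<approx> G \<or> X \<approx> graph_complement G"
  shows "realization_graph X \<approx> T"
  using assms both_realize_iso iso_has_triangle has_triangle_complement by metis

lemma catalogued_iso:
  assumes "has_triangle G M" "has_triangle X M \<or> has_triangle X (co_triangle M)"
  shows "X \<approx> G \<or> X \<approx> graph_complement G"
  using assms has_triangle_imp_iso has_triangle_complement by metis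

theorem theorem7p7:
  fixes X :: "'a graph"
  assumes "graph X" and "prime_graph X" and "two_switch_degree X \<le> 4"
  shows
   "(X \<approx> P4
       \<longrightarrow> realization_graph X \<approx> complete_graph 2) \<and>
    (X \<approx> C4 \<or> X \<approx> two_K2 \<or> X \<approx> D_graph 2 1 \<or> X \<approx> graph_complement (D_graph 2 1)
       \<longrightarrow> realization_graph X \<approx> complete_graph 3) \<and>
    (X \<approx> D_graph 3 1 \<or> X \<approx> graph_complement (D_graph 3 1)
       \<longrightarrow> realization_graph X \<approx> complete_graph 4) \<and>
    (X \<approx> T_111 \<or> X \<approx> graph_complement T_111
       \<longrightarrow> realization_graph X \<approx> complete_multipartite [3, 3]) \<and>
    (X \<approx> T_221 \<or> X \<approx> graph_complement T_221 \<or> X \<approx> R_211 \<or> X \<approx> graph_complement R_211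
       \<longrightarrow> realization_graph X \<approx> complete_multipartite [1, 2, 2]) \<and>
    (X \<approx> D_graph 4 1 \<or> X \<approx> graph_complement (D_graph 4 1)
       \<longrightarrow> realization_graph X \<approx> complete_graph 5) \<and>
    (X \<approx> D_graph 2 2 \<or> X \<approx> graph_complement (D_graph 2 2) \<or>
     X \<approx> B_graph 1 \<or> X \<approx> graph_complement (B_graph 1) \<or>
     X \<approx> B_graph 3 \<or> X \<approx> graph_complement (B_graph 3)
       \<longrightarrow> realization_graph X \<approx> complete_multipartite [2, 2, 2]) \<and>
    (X \<approx> B_graph 2 \<or> X \<approx> graph_complement (B_graph 2)
       \<longrightarrow> realization_graph X \<approx> complete_multipartite [1, 3, 3]) \<and>
    (X \<approx> R_311 \<or> X \<approx> graph_complement R_311 \<or> X \<approx> R_331 \<or> X \<approx> graph_complement R_331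
       \<longrightarrow> realization_graph X \<approx> calG1) \<and>
    (X \<approx> R_321 \<or> X \<approx> graph_complement R_321
       \<longrightarrow> realization_graph X \<approx> calG2) \<and>
    (X \<approx> P4 \<or>
     X \<approx> C4 \<or> X \<approx> two_K2 \<or> X \<approx> D_graph 2 1 \<or> X \<approx> graph_complement (D_graph 2 1) \<or>
     X \<approx> D_graph 3 1 \<or> X \<approx> graph_complement (D_graph 3 1) \<or>
     X \<approx> T_111 \<or> X \<approx> graph_complement T_111 \<or>
     X \<approx> T_221 \<or> X \<approx> graph_complement T_221 \<or> X \<approx> R_211 \<or> X \<approx> graph_complement R_211 \<or>
     X \<approx> D_graph 4 1 \<or> X \<approx> graph_complement (D_graph 4 1) \<or>
     X \<approx> D_graph 2 2 \<or> X \<approx> graph_complement (D_graph 2 2) \<or>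
     X \<approx> B_graph 1 \<or> X \<approx> graph_complement (B_graph 1) \<or>
     X \<approx> B_graph 3 \<or> X \<approx> graph_complement (B_graph 3) \<or>
     X \<approx> B_graph 2 \<or> X \<approx> graph_complement (B_graph 2) \<or>
     X \<approx> R_311 \<or> X \<approx> graph_complement R_311 \<or> X \<approx> R_331 \<or> X \<approx> graph_complement R_331 \<or>
     X \<approx> R_321 \<or> X \<approx> graph_complement R_321)"
proof (intro conjI)
  note complete = has_triangle_complete_graph and multipartite = has_triangle_complete_multipartite
  note iso = realization_graph_iso[OF assms(1)]
  show "X \<approx> P4 \<longrightarrow> realization_graph X \<approx> complete_graph 2"
    using iso[OF complete realization_table(1) small_named_graphs(1)] by blast
  show "X \<approx> C4 \<or> X \<approx> two_K2 \<or> X \<approx> D_graph 2 1 \<or> X \<approx> graph_complement (D_graph 2 1)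
      \<longrightarrow> realization_graph X \<approx> complete_graph 3"
    using iso[OF complete realization_table(2) small_named_graphs(2)]
      both_realize_iso[OF assms(1) complete realization_table(2)]
      iso_has_triangle[OF assms(1) _ small_named_graphs(3)]
      iso[OF complete realization_table(3) named_split_graphs(1)] by blast
  show "X \<approx> D_graph 3 1 \<or> X \<approx> graph_complement (D_graph 3 1)
      \<longrightarrow> realization_graph X \<approx> complete_graph 4"
    using iso[OF complete realization_table(4) named_split_graphs(1)] by blast
  show "X \<approx> T_111 \<or> X \<approx> graph_complement T_111
      \<longrightarrow> realization_graph X \<approx> complete_multipartite [3, 3]"
    using iso[OF multipartite realization_table(5) named_split_graphs(2)] by blast
  show "X \<approx> T_221 \<or> X \<approx> graph_complement T_221 \<or> X \<approx> R_211 \<or> X \<approx> graph_complement R_211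
      \<longrightarrow> realization_graph X \<approx> complete_multipartite [1, 2, 2]"
    using iso[OF multipartite realization_table(6) named_split_graphs(3)]
      iso[OF multipartite realization_table(7) named_split_graphs(4)] by blast
  show "X \<approx> D_graph 4 1 \<or> X \<approx> graph_complement (D_graph 4 1)
      \<longrightarrow> realization_graph X \<approx> complete_graph 5"
    using iso[OF complete realization_table(8) named_split_graphs(1)] by blast
  show "X \<approx> D_graph 2 2 \<or> X \<approx> graph_complement (D_graph 2 2) \<or>
      X \<approx> B_graph 1 \<or> X \<approx> graph_complement (B_graph 1) \<or>
      X \<approx> B_graph 3 \<or> X \<approx> graph_complement (B_graph 3)
      \<longrightarrow> realization_graph X \<approx> complete_multipartite [2, 2, 2]"
    using iso[OF multipartite realization_table(9) named_split_graphs(1)]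
      iso[OF multipartite realization_table(10) has_triangle_B_graph]
      iso[OF multipartite realization_table(11) has_triangle_B_graph] by force
  show "X \<approx> B_graph 2 \<or> X \<approx> graph_complement (B_graph 2)
      \<longrightarrow> realization_graph X \<approx> complete_multipartite [1, 3, 3]"
    using iso[OF multipartite realization_table(12) has_triangle_B_graph] by force
  show "X \<approx> R_311 \<or> X \<approx> graph_complement R_311 \<or> X \<approx> R_331 \<or> X \<approx> graph_complement R_331
      \<longrightarrow> realization_graph X \<approx> calG1"
    using iso[OF has_triangle_calG(1) realization_table(13) named_split_graphs(5)]
      iso[OF has_triangle_calG(1) realization_table(14) named_split_graphs(6)] by blast
  show "X \<approx> R_321 \<or> X \<approx> graph_complement R_321 \<longrightarrow> realization_graph X \<approx> calG2"
    using iso[OF has_triangle_calG(2) realization_table(15) named_split_graphs(7)] by blast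
next
  obtain vs where vs: "distinct vs" "set vs \<subseteq> verts X"
      "triangle X vs \<in> {P4_triangle, C4_triangle, co_triangle C4_triangle}"
    using prime_start[OF assms(1,2)] by blast
  then have "triangle X vs \<in> set catalogue"
    by (auto simp: catalogue_def base_def)
  moreover have "[] \<notin> set catalogue"
    by code_simp
  ultimately obtain M where M: "M \<in> set catalogue" "has_triangle X M"
    using indecomposable_has_catalogued_triangle[of X catalogue vs] assms vs(1,2) catalogue_closed
    by (auto simp: prime_graph_def)
  have C4: "X \<approx> C4 \<or> X \<approx> two_K2" if "has_triangle X C4_triangle \<or> has_triangle X (co_triangle C4_triangle)"
    using that has_triangle_imp_iso small_named_graphs by blast
  have B: "X \<approx> B_graph j \<or> X \<approx> graph_complement (B_graph j)"
    if "has_triangle X (B_triangle j) \<or> has_triangle X (co_triangle (B_triangle j))" "j \<le> 4" for j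
    using that catalogued_iso has_triangle_B_graph by blast
  from M consider "has_triangle X P4_triangle"
    | N where "N \<in> set base" "has_triangle X N \<or> has_triangle X (co_triangle N)"
    by (auto simp: catalogue_def)
  then show "X \<approx> P4 \<or>
     X \<approx> C4 \<or> X \<approx> two_K2 \<or> X \<approx> D_graph 2 1 \<or> X \<approx> graph_complement (D_graph 2 1) \<or>
     X \<approx> D_graph 3 1 \<or> X \<approx> graph_complement (D_graph 3 1) \<or>
     X \<approx> T_111 \<or> X \<approx> graph_complement T_111 \<or>
     X \<approx> T_221 \<or> X \<approx> graph_complement T_221 \<or> X \<approx> R_211 \<or> X \<approx> graph_complement R_211 \<or>
     X \<approx> D_graph 4 1 \<or> X \<approx> graph_complement (D_graph 4 1) \<or>
     X \<approx> D_graph 2 2 \<or> X \<approx> graph_complement (D_graph 2 2) \<or>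
     X \<approx> B_graph 1 \<or> X \<approx> graph_complement (B_graph 1) \<or>
     X \<approx> B_graph 3 \<or> X \<approx> graph_complement (B_graph 3) \<or>
     X \<approx> B_graph 2 \<or> X \<approx> graph_complement (B_graph 2) \<or>
     X \<approx> R_311 \<or> X \<approx> graph_complement R_311 \<or> X \<approx> R_331 \<or> X \<approx> graph_complement R_331 \<or>
     X \<approx> R_321 \<or> X \<approx> graph_complement R_321"
  proof cases
    case 1
    then show ?thesis
      using has_triangle_imp_iso small_named_graphs(1) by blast
  next
    case 2
    have "N = C4_triangle \<Longrightarrow> X \<approx> C4 \<or> X \<approx> two_K2"
      using C4 2(2) by blast
    moreover have "N = D_triangle p q \<Longrightarrow> X \<approx> D_graph p q \<or> X \<approx> graph_complement (D_graph p q)" for p q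
      using catalogued_iso[OF named_split_graphs(1)] 2(2) by blast
    moreover have "N = B_triangle 1 \<Longrightarrow> X \<approx> B_graph 1 \<or> X \<approx> graph_complement (B_graph 1)"
      "N = B_triangle 2 \<Longrightarrow> X \<approx> B_graph 2 \<or> X \<approx> graph_complement (B_graph 2)"
      "N = B_triangle 3 \<Longrightarrow> X \<approx> B_graph 3 \<or> X \<approx> graph_complement (B_graph 3)"
      using B[of 1] B[of 2] B[of 3] 2(2) by auto
    moreover have "N = T_111_triangle \<Longrightarrow> X \<approx> T_111 \<or> X \<approx> graph_complement T_111"
      "N = T_221_triangle \<Longrightarrow> X \<approx> T_221 \<or> X \<approx> graph_complement T_221"
      "N = R_211_triangle \<Longrightarrow> X \<approx> R_211 \<or> X \<approx> graph_complement R_211"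
      "N = R_311_triangle \<Longrightarrow> X \<approx> R_311 \<or> X \<approx> graph_complement R_311"
      "N = R_331_triangle \<Longrightarrow> X \<approx> R_331 \<or> X \<approx> graph_complement R_331"
      "N = R_321_triangle \<Longrightarrow> X \<approx> R_321 \<or> X \<approx> graph_complement R_321"
      using catalogued_iso[OF named_split_graphs(2)] catalogued_iso[OF named_split_graphs(3)]
        catalogued_iso[OF named_split_graphs(4)] catalogued_iso[OF named_split_graphs(5)]
        catalogued_iso[OF named_split_graphs(6)] catalogued_iso[OF named_split_graphs(7)] 2(2)
      by blast+
    moreover have "N = C4_triangle \<or> N = D_triangle 2 1 \<or> N = D_triangle 3 1 \<or> N = T_111_triangle \<or>
        N = T_221_triangle \<or> N = R_211_triangle \<or> N = D_triangle 4 1 \<or> N = D_triangle 2 2 \<or>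
        N = B_triangle 1 \<or> N = B_triangle 3 \<or> N = B_triangle 2 \<or> N = R_311_triangle \<or>
        N = R_331_triangle \<or> N = R_321_triangle"
      using 2(1) unfolding base_def by (simp only: list.set insert_iff empty_iff simp_thms)
    ultimately show ?thesis
      by metis
  qed
qed

end
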